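(* Let $d \geq 2$ be an integer and $T$ a tree of order $n$ with $\ell$ leaves. If $n \geq d$, then $\gamma_d^1(T) \leq \frac{n+\ell}{d+2}$, with equality if and only if $T \in \{P_d\} \cup \mathcal{T}_d$.
   Context: $\gamma_d^1(G)$ is the minimum size of an independent set $S\subseteq V(G)$ such that every vertex not in $S$ is at distance at most $d$ from some vertex of $S$. $P_d$ is the path on $d$ vertices. $T^*\circ P_d$ is obtained from $T^*$ by attaching to each vertex $v$ of $T^*$ its own new copy of $P_d$ via an edge from $v$ to an end vertex of the copy, and $\mathcal{T}_d=\{T^*\circ P_d: T^*\text{ a tree with at least two vertices}\}$. *)

theory Defs
  imports "Graph_Theory.Graph_Theory"
begin

text \<open>
  A finite simple graph is a symmetric, loop-free, finite digraph whose arcs are pairs of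
  vertices (the locale \<^locale>\<open>pair_graph\<close>); each edge is represented by its two opposite arcs.
\<close>

text \<open>
  The library constants \<^const>\<open>forest\<close> and \<^const>\<open>tree\<close> are unsuitable for symmetric digraphs:
  the closed walk traversing an edge back and forth counts as a \<^const>\<open>pre_digraph.cycle\<close>.
  The cycles of a simple graph are the library's cycles of length at least 3.
\<close>

definition graph_tree :: "'a pair_pre_digraph \<Rightarrow> bool" where
  "graph_tree G \<longleftrightarrow>
     pair_graph G \<and>
     connected (with_proj G) \<and>
     \<not> (\<exists>p. pre_digraph.cycle (with_proj G) p \<and> length p \<ge> 3)"

text \<open>By symmetry the out-degree is the degree in the undirected sense.\<close>

definition leaves :: "'a pair_pre_digraph \<Rightarrow> 'a set" where
  "leaves G = {v \<in> pverts G. out_degree (with_proj G) v = 1}"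

definition graph_dist :: "'a pair_pre_digraph \<Rightarrow> 'a \<Rightarrow> 'a \<Rightarrow> ereal" where
  "graph_dist G u v = wf_digraph.\<mu> (with_proj G) (\<lambda>_. 1) u v"

definition independent_set :: "'a pair_pre_digraph \<Rightarrow> 'a set \<Rightarrow> bool" where
  "independent_set G S \<longleftrightarrow>
     S \<subseteq> pverts G \<and> (\<forall>u\<in>S. \<forall>v\<in>S. (u, v) \<notin> parcs G)"

definition distance_dominating :: "nat \<Rightarrow> 'a pair_pre_digraph \<Rightarrow> 'a set \<Rightarrow> bool" where
  "distance_dominating d G S \<longleftrightarrow>
     (\<forall>v \<in> pverts G - S. \<exists>u\<in>S. graph_dist G v u \<le> ereal (real d))"

text \<open>
  The number \<open>\<gamma>\<close> with subscript \<open>d\<close> and superscript \<open>1\<close>. In a finite simple graph the minimum is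
  over a nonempty set of sizes, since every maximal independent set is dominating for \<open>d \<ge> 1\<close>.
\<close>

definition indep_dist_dom_number :: "nat \<Rightarrow> 'a pair_pre_digraph \<Rightarrow> nat" where
  "indep_dist_dom_number d G =
     (LEAST k. \<exists>S. independent_set G S \<and> distance_dominating d G S \<and> card S = k)"

definition path_graph :: "nat \<Rightarrow> nat pair_pre_digraph" where
  "path_graph d =
     \<lparr> pverts = {0..<d},
       parcs = {(i, j). i < d \<and> j < d \<and> (j = i + 1 \<or> i = j + 1)} \<rparr>"

text \<open>
  The graph \<open>G \<circ> P\<^sub>d\<close>, for \<open>d \<ge> 1\<close>: \<open>Inl v\<close> is the vertex \<open>v\<close> of \<open>G\<close>, and \<open>Inr (v, i)\<close> is the
  vertex \<open>i\<close> of the copy of \<open>P\<^sub>d\<close> attached to \<open>v\<close>.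
\<close>

definition attach_paths ::
    "'a pair_pre_digraph \<Rightarrow> nat \<Rightarrow> ('a + 'a \<times> nat) pair_pre_digraph" where
  "attach_paths G d =
     \<lparr> pverts = Inl ` pverts G \<union> Inr ` (pverts G \<times> pverts (path_graph d)),
       parcs = {(Inl u, Inl v) | u v. (u, v) \<in> parcs G}
             \<union> {(Inr (v, i), Inr (v, j)) | v i j. v \<in> pverts G \<and> (i, j) \<in> parcs (path_graph d)}
             \<union> {(Inl v, Inr (v, 0)) | v. v \<in> pverts G}
             \<union> {(Inr (v, 0), Inl v) | v. v \<in> pverts G} \<rparr>"

definition graph_iso :: "'a pair_pre_digraph \<Rightarrow> 'b pair_pre_digraph \<Rightarrow> bool" where
  "graph_iso G H \<longleftrightarrow> digraph_iso (with_proj G) (with_proj H)"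

text \<open>
  Membership in the family of all \<open>T\<^sup>* \<circ> P\<^sub>d\<close>, up to isomorphism. Taking the vertices of \<open>T\<^sup>*\<close>
  from the vertex type of \<open>T\<close> is no restriction: if \<open>T\<close> is isomorphic to \<open>T\<^sup>* \<circ> P\<^sub>d\<close>, then \<open>T\<^sup>*\<close> is
  isomorphic to an induced subgraph of \<open>T\<close>.
\<close>

definition in_tree_family :: "nat \<Rightarrow> 'a pair_pre_digraph \<Rightarrow> bool" where
  "in_tree_family d T \<longleftrightarrow>
     (\<exists>Tstar :: 'a pair_pre_digraph.
        graph_tree Tstar \<and> card (pverts Tstar) \<ge> 2 \<and> graph_iso T (attach_paths Tstar d))"

end

theory Submission
  imports Defs
begin

text \<open>
  Root the tree at an end \<open>r\<close> of a longest path and fix \<open>t \<le> d\<close>. For each residue \<open>i\<close> modulo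
  \<open>d + 1 + t\<close> take the vertices of level \<open>i\<close>, the leaves other than \<open>r\<close> of levels \<open>i - 1, \<dots>, i - t\<close>,
  and also \<open>r\<close> if \<open>i > d\<close>: when the diameter is at least \<open>d\<close>, each of these sets is independent and
  \<open>d\<close>-dominating (the vertices above level \<open>i \<le> d\<close> are dominated from the longest path). Together
  they have at most \<open>n + t\<ell>\<close> elements, so \<open>(d + 1 + t) \<gamma> \<le> n + t\<ell>\<close>. The cases \<open>t = 0\<close> and
  \<open>t = 2\<close> add up to the claimed bound, and equality forces \<open>\<gamma> = \<ell>\<close> and \<open>n = (d + 1) \<ell>\<close>. If the
  diameter is smaller than \<open>d\<close>, then \<open>\<gamma> = 1\<close> and only \<open>P\<^sub>d\<close> is extremal.

  In the extremal case, follow a leaf up to the first vertex \<open>q\<close> of degree at least 3, at distance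
  \<open>k\<close>. Removing the \<open>k\<close> vertices before \<open>q\<close>, the sets of the remaining tree have at least \<open>\<ell> - 1\<close>
  elements, and at least \<open>\<ell>\<close> elements as soon as they come within distance \<open>d - k\<close> of \<open>q\<close>.
  For \<open>k < d\<close> and \<open>t = 0\<close> this exceeds the number of remaining vertices. Likewise, two leaves at
  distance \<open>d\<close> from the same \<open>q\<close> contradict the count for \<open>t = 1\<close>. Hence the initial paths of
  \<open>d + 1\<close> vertices at the leaves are disjoint, and by counting they cover the tree.
\<close>

section \<open>Levels in a tree\<close>

text \<open>
  Acyclicity is stated as: the ends of an edge are not connected by any walk avoiding that edge.
\<close>

definition utree :: "'a set \<Rightarrow> ('a \<times> 'a) set \<Rightarrow> bool" where
  "utree V E \<longleftrightarrow> finite V \<and> E \<subseteq> V \<times> V \<and> sym E \<and> (\<forall>u\<in>V. \<forall>v\<in>V. (u, v) \<in> E\<^sup>*) \<and>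
     (\<forall>u v. (u, v) \<in> E \<longrightarrow> (u, v) \<notin> (E - {(u, v), (v, u)})\<^sup>*)"

definition leaf_set :: "'a set \<Rightarrow> ('a \<times> 'a) set \<Rightarrow> 'a set" where
  "leaf_set V E = {v \<in> V. card (E `` {v}) = 1}"

text \<open>Distances are bounded by the existence of walks, i.e. by powers of the arc relation.\<close>

definition indep_dom :: "nat \<Rightarrow> 'a set \<Rightarrow> ('a \<times> 'a) set \<Rightarrow> 'a set \<Rightarrow> bool" where
  "indep_dom d V E S \<longleftrightarrow> S \<subseteq> V \<and> (\<forall>u\<in>S. \<forall>v\<in>S. (u, v) \<notin> E) \<and>
     (\<forall>v\<in>V. \<exists>u\<in>S. \<exists>k\<le>d. (v, u) \<in> E ^^ k)"

lemma leaf_unique: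
  assumes "v \<in> leaf_set V E" "(v, a) \<in> E" "(v, b) \<in> E"
  shows "a = b"
proof -
  obtain c where "E `` {v} = {c}" using assms(1) by (auto simp: leaf_set_def card_1_singleton_iff)
  then show ?thesis using assms by (metis Image_singleton_iff singletonD)
qed

text \<open>Acyclicity is encoded by \<open>edge_par\<close>: every edge joins a vertex to its
  parent. \<open>par r\<close> and the values of \<open>lev\<close> and \<open>par\<close> outside
  \<open>V\<close> are arbitrary.\<close>

locale levelled_tree =
  fixes V :: "'a set" and E :: "('a \<times> 'a) set" and r :: 'a
    and lev :: "'a \<Rightarrow> nat" and par :: "'a \<Rightarrow> 'a"
  assumes finV: "finite V"
    and arcs_in: "E \<subseteq> V \<times> V"
    and symE: "(u, v) \<in> E \<Longrightarrow> (v, u) \<in> E"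
    and root_in: "r \<in> V"
    and lev_root: "lev r = 0"
    and par_edge: "v \<in> V \<Longrightarrow> v \<noteq> r \<Longrightarrow> (v, par v) \<in> E"
    and lev_par: "v \<in> V \<Longrightarrow> v \<noteq> r \<Longrightarrow> lev v = Suc (lev (par v))"
    and edge_par: "(u, v) \<in> E \<Longrightarrow> u = par v \<and> v \<noteq> r \<or> v = par u \<and> u \<noteq> r"
begin

text \<open>Intended for \<open>i \<le> lev v\<close>; for larger \<open>i\<close> the truncated
  difference makes it \<open>v\<close>.\<close>

definition anc :: "nat \<Rightarrow> 'a \<Rightarrow> 'a" where
  "anc i v = (par ^^ (lev v - i)) v"

lemma lev_eq_0: "v \<in> V \<Longrightarrow> lev v = 0 \<longleftrightarrow> v = r"
  using lev_par lev_root by fastforce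

lemma edge_lev:
  assumes "(u, v) \<in> E"
  shows "u = par v \<and> lev v = Suc (lev u) \<or> v = par u \<and> lev u = Suc (lev v)"
  using edge_par[OF assms] lev_par arcs_in assms by blast

lemma funpow_par:
  assumes "v \<in> V" "n \<le> lev v"
  shows "(par ^^ n) v \<in> V \<and> lev ((par ^^ n) v) = lev v - n \<and> (v, (par ^^ n) v) \<in> E ^^ n"
  using assms(2)
proof (induction n)
  case 0
  then show ?case using assms by simp
next
  case (Suc n)
  let ?w = "(par ^^ n) v"
  have IH: "?w \<in> V" "lev ?w = lev v - n" "(v, ?w) \<in> E ^^ n" using Suc by auto
  have "?w \<noteq> r" using IH Suc.prems lev_root by auto
  then have "(?w, par ?w) \<in> E" "lev ?w = Suc (lev (par ?w))"
    using par_edge lev_par IH by auto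
  then show ?case using IH arcs_in by auto
qed

lemma anc_facts:
  assumes "v \<in> V" "i \<le> lev v"
  shows "anc i v \<in> V" "lev (anc i v) = i" "(v, anc i v) \<in> E ^^ (lev v - i)"
  using funpow_par[OF assms(1), of "lev v - i"] assms(2) by (auto simp: anc_def)

lemma anc_self: "anc (lev v) v = v"
  by (simp add: anc_def)

lemma anc_edge:
  assumes "(u, v) \<in> E" "i \<le> lev u" "i \<le> lev v"
  shows "anc i u = anc i v"
proof -
  have *: "anc i b = anc i a" if "a = par b" "lev b = Suc (lev a)" "i \<le> lev a" for a b
  proof -
    have "lev b - i = Suc (lev a - i)" using that by simp
    then show ?thesis using that by (simp add: anc_def funpow_swap1)
  qed
  show ?thesis using edge_lev[OF assms(1)] *[of u v] *[of v u] assms by auto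
qed

text \<open>Read backwards from \<open>x\<close>, the walk keeps its ancestor of level
  \<open>i\<close> while it stays on levels at least \<open>i\<close>. Before leaving them it is
  therefore at \<open>anc i x\<close>, and from there to \<open>x\<close> it needs at least
  \<open>lev x - i\<close> steps.\<close>

lemma walk_to_anc:
  assumes "(w, x) \<in> E ^^ k" "lev w \<le> i" "i \<le> lev x"
  shows "\<exists>j. (w, anc i x) \<in> E ^^ j \<and> j + (lev x - i) \<le> k"
  using assms(1,3)
proof (induction k arbitrary: x)
  case 0
  then show ?case using assms(2) anc_self[of x] by (auto intro!: exI[of _ 0])
next
  case (Suc k)
  then obtain x' where x': "(w, x') \<in> E ^^ k" "(x', x) \<in> E" by auto
  show ?case
  proof (cases "i \<le> lev x'")
    case True
    then obtain j where j: "(w, anc i x') \<in> E ^^ j" "j + (lev x' - i) \<le> k"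
      using Suc.IH x' by blast
    moreover have "anc i x' = anc i x" using anc_edge x' True Suc.prems by blast
    moreover have "lev x \<le> Suc (lev x')" using edge_lev[OF x'(2)] by auto
    ultimately show ?thesis by (intro exI[of _ j]) auto
  next
    case False
    then have "lev x = i" using edge_lev[OF x'(2)] Suc.prems by auto
    then show ?thesis using Suc.prems anc_self[of x] by (intro exI[of _ "Suc k"]) auto
  qed
qed

text \<open>The subtree below \<open>anc c w\<close> can be left only through
  \<open>anc c w\<close>, and reaching that vertex from \<open>w\<close> takes at least
  \<open>lev w - c\<close> steps.\<close>

lemma walk_from_subtree:
  assumes "(w, y) \<in> E ^^ k" "c \<le> lev w"
  shows "(\<exists>j. (anc c w, y) \<in> E ^^ j \<and> j + (lev w - c) \<le> k) \<or> c \<le> lev y \<and> anc c y = anc c w"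
  using assms
proof (induction k arbitrary: w)
  case 0
  then show ?case by auto
next
  case (Suc k)
  then obtain w' where w': "(w, w') \<in> E" "(w', y) \<in> E ^^ k"
    by (meson relpow_Suc_E2)
  show ?case
  proof (cases "c \<le> lev w'")
    case True
    have "anc c w = anc c w'" using anc_edge w' True Suc.prems by blast
    moreover have "lev w \<le> Suc (lev w')" using edge_lev[OF w'(1)] by auto
    moreover have "(\<exists>j. (anc c w', y) \<in> E ^^ j \<and> j + (lev w' - c) \<le> k) \<or>
        c \<le> lev y \<and> anc c y = anc c w'"
      using Suc.IH[OF w'(2) True] .
    ultimately show ?thesis by fastforce
  next
    case False
    then have "lev w = c" using edge_lev[OF w'(1)] Suc.prems by auto
    then show ?thesis using Suc.prems anc_self[of w] by (intro disjI1 exI[of _ "Suc k"]) auto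
  qed
qed

lemma no_loop: "(v, v) \<notin> E"
  using edge_lev[of v v] by auto

lemma leaf_iff:
  assumes "v \<in> V" "v \<noteq> r"
  shows "v \<in> leaf_set V E \<longleftrightarrow> (\<forall>c. (v, c) \<in> E \<longrightarrow> lev c < lev v)"
proof -
  have p: "par v \<in> E `` {v}" using par_edge assms by auto
  have fin: "finite (E `` {v})" using finV arcs_in by (auto intro: finite_subset)
  show ?thesis
  proof
    assume "v \<in> leaf_set V E"
    then have "c = par v" if "(v, c) \<in> E" for c using p that by (auto dest: leaf_unique)
    then show "\<forall>c. (v, c) \<in> E \<longrightarrow> lev c < lev v" using lev_par[OF assms] by fastforce
  next
    assume "\<forall>c. (v, c) \<in> E \<longrightarrow> lev c < lev v"
    then have "E `` {v} = {par v}" using p edge_lev by fastforce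
    then show "v \<in> leaf_set V E" using assms by (simp add: leaf_set_def)
  qed
qed

end

text \<open>\<open>r\<close> and \<open>x\<close> play the ends of a longest path, of length
  \<open>lev x\<close>; only the resulting bounds on the distances from these two ends are
  recorded.\<close>

locale diam_tree = levelled_tree +
  fixes x :: 'a
  assumes x_in: "x \<in> V"
    and lev_le: "v \<in> V \<Longrightarrow> lev v \<le> lev x"
    and walk_to_x: "v \<in> V \<Longrightarrow> \<exists>k\<le>lev x. (v, x) \<in> E ^^ k"
begin

text \<open>A walk of length at most \<open>lev x\<close> from \<open>w\<close> to \<open>x\<close>
  passes through \<open>anc i x\<close> and spends at least \<open>lev x - i\<close> steps after it.
  So the longest path can stand in for ancestors when \<open>w\<close> is too close to the
  root.\<close>

lemma walk_to_diam:
  assumes "w \<in> V" "lev w \<le> i" "i \<le> lev x"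
  shows "\<exists>j\<le>i. (w, anc i x) \<in> E ^^ j"
proof -
  obtain k where k: "k \<le> lev x" "(w, x) \<in> E ^^ k" using walk_to_x assms by blast
  obtain j where "(w, anc i x) \<in> E ^^ j" "j + (lev x - i) \<le> k"
    using walk_to_anc[OF k(2) assms(2,3)] by blast
  then show ?thesis using k assms(3) by (intro exI[of _ j]) auto
qed

text \<open>A neighbour of \<open>r\<close> has level 1, hence is within distance 1 of
  \<open>anc 1 x\<close>. Vertices of equal level are not adjacent, so it is
  \<open>anc 1 x\<close>.\<close>

lemma root_leaf:
  assumes "lev x \<noteq> 0"
  shows "r \<in> leaf_set V E"
proof -
  have "s = anc 1 x" if s: "(r, s) \<in> E" for s
  proof -
    have sV: "s \<in> V" using s arcs_in by auto
    have ls: "lev s = 1" using edge_lev[OF s] lev_root by auto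
    obtain j where j: "j \<le> 1" "(s, anc 1 x) \<in> E ^^ j"
      using walk_to_diam[OF sV, of 1] ls assms by auto
    have l1: "lev (anc 1 x) = 1" using anc_facts[OF x_in, of 1] assms by auto
    have "j \<noteq> 1"
    proof
      assume "j = 1"
      then have "(s, anc 1 x) \<in> E" using j by simp
      then show False using edge_lev l1 ls by fastforce
    qed
    then have "j = 0" using j by auto
    then show ?thesis using j by auto
  qed
  moreover have "(r, anc 1 x) \<in> E"
  proof -
    let ?y = "anc 1 x"
    have y: "?y \<in> V" "lev ?y = 1" using anc_facts[OF x_in, of 1] assms by auto
    then have "?y \<noteq> r" using lev_root by auto
    then have "(?y, par ?y) \<in> E" "lev (par ?y) = 0" using par_edge lev_par y by auto
    moreover have "par ?y = r" using calculation lev_eq_0 arcs_in by blast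
    ultimately show ?thesis using symE by auto
  qed
  ultimately have "E `` {r} = {anc 1 x}" by blast
  then show ?thesis using root_in by (simp add: leaf_set_def)
qed

lemma x_leaf:
  assumes "lev x \<noteq> 0"
  shows "x \<in> leaf_set V E" "x \<noteq> r"
proof -
  show "x \<noteq> r" using assms lev_root by auto
  have "lev c < lev x" if "(x, c) \<in> E" for c
    using edge_lev[OF that] lev_le[of c] arcs_in that by auto
  then show "x \<in> leaf_set V E"
    using leaf_iff[OF x_in \<open>x \<noteq> r\<close>] by blast
qed

end

lemma relpow_converse_sym:
  assumes "sym E" "(u, v) \<in> E ^^ k"
  shows "(v, u) \<in> E ^^ k"
  using assms(2)
proof (induction k arbitrary: v)
  case 0
  then show ?case by auto
next
  case (Suc k)
  then obtain w where "(u, w) \<in> E ^^ k" "(w, v) \<in> E" by auto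
  then show ?case using Suc.IH assms(1) by (meson relpow_Suc_I2 symD)
qed

text \<open>\<open>r\<close> and \<open>x\<close> are chosen at maximal distance, and levels are
  distances from \<open>r\<close>. Acyclicity enters in the uniqueness of the parent.\<close>

lemma utree_diam_tree:
  assumes T: "utree V E" and ne: "V \<noteq> {}"
  obtains r lev par x where "diam_tree V E r lev par x"
proof -
  have finV: "finite V" and arcs: "E \<subseteq> V \<times> V" and sym: "sym E"
    and conn: "\<And>u v. u \<in> V \<Longrightarrow> v \<in> V \<Longrightarrow> (u, v) \<in> E\<^sup>*"
    and bridge: "\<And>u v. (u, v) \<in> E \<Longrightarrow> (u, v) \<notin> (E - {(u, v), (v, u)})\<^sup>*"
    using T by (auto simp: utree_def)
  define dst where "dst u v = (LEAST k. (u, v) \<in> E ^^ k)" for u v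
  have dst_walk: "(u, v) \<in> E ^^ dst u v" if "u \<in> V" "v \<in> V" for u v
    unfolding dst_def using conn[OF that] by (auto simp: rtrancl_power intro: LeastI)
  have dst_le: "dst u v \<le> k" if "(u, v) \<in> E ^^ k" for u v k
    unfolding dst_def using that by (rule Least_le)
  have "finite (V \<times> V)" "V \<times> V \<noteq> {}" using finV ne by auto
  then have "Max (case_prod dst ` (V \<times> V)) \<in> case_prod dst ` (V \<times> V)"
    by (intro Max_in) auto
  then obtain z where z: "z \<in> V \<times> V" "case_prod dst z = Max (case_prod dst ` (V \<times> V))"
    by auto
  have z: "z \<in> V \<times> V" "\<And>y. y \<in> V \<times> V \<Longrightarrow> case_prod dst y \<le> case_prod dst z"
    using z \<open>finite (V \<times> V)\<close> by auto
  obtain r x where rx: "z = (r, x)" by (cases z)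
  have rV: "r \<in> V" and xV: "x \<in> V" using z rx by auto
  have mx: "dst u v \<le> dst r x" if "u \<in> V" "v \<in> V" for u v
    using z(2)[of "(u, v)"] that rx by auto
  define lev where "lev = dst r"
  have lev_r: "lev r = 0" unfolding lev_def using dst_le[of r r 0] by simp
  have lev0: "v = r" if "v \<in> V" "lev v = 0" for v
    using dst_walk[OF rV that(1)] that(2) by (simp add: lev_def)
  have lev_edge: "lev v \<le> Suc (lev u)" if "(u, v) \<in> E" for u v
  proof -
    have "u \<in> V" using that arcs by auto
    then have "(r, v) \<in> E ^^ Suc (lev u)" using dst_walk[OF rV] that unfolding lev_def by auto
    then show ?thesis unfolding lev_def by (rule dst_le)
  qed
  have ex_par: "\<exists>p. (v, p) \<in> E \<and> lev v = Suc (lev p)" if "v \<in> V" "v \<noteq> r" for v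
  proof -
    have "lev v \<noteq> 0" using lev0 that by blast
    then obtain k where k: "lev v = Suc k" by (cases "lev v") auto
    then have "(r, v) \<in> E ^^ Suc k" using dst_walk[OF rV that(1)] by (simp add: lev_def)
    then obtain p where p: "(r, p) \<in> E ^^ k" "(p, v) \<in> E" by auto
    have "lev p \<le> k" unfolding lev_def using dst_le p by auto
    then show ?thesis using lev_edge[OF p(2)] k p sym by (auto intro!: exI[of _ p] dest: symD)
  qed
  define par where "par v = (SOME p. (v, p) \<in> E \<and> lev v = Suc (lev p))" for v
  have par: "(v, par v) \<in> E" "lev v = Suc (lev (par v))" if "v \<in> V" "v \<noteq> r" for v
    using someI_ex[OF ex_par[OF that]] by (auto simp: par_def)
  have irr: "(v, v) \<notin> E" for v using bridge by blast
  \<comment> \<open>The bounds allow equal levels, so this also rules out edges inside a level. From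
    \<open>p\<close> and from \<open>q\<close> one descends to \<open>r\<close> without meeting
    \<open>v\<close>; this connects \<open>v\<close> with \<open>p\<close> without using their
    edge.\<close>
  have uniq: "p = q" if "(v, p) \<in> E" "(v, q) \<in> E" "lev p \<le> lev v" "lev q \<le> lev v" for v p q
  proof (rule ccontr)
    assume pq: "p \<noteq> q"
    let ?F = "E - {(v, p), (p, v)}"
    have symF: "sym ?F" using sym by (auto simp: sym_def)
    have down: "(w, r) \<in> ?F\<^sup>*" if "w \<in> V" "lev w \<le> lev v" "w \<noteq> v" for w
      using that
    proof (induction "lev w" arbitrary: w)
      case 0
      then show ?case using lev0 by auto
    next
      case (Suc k)
      have wr: "w \<noteq> r" using Suc lev_r by auto
      have pw: "(w, par w) \<in> E" "lev w = Suc (lev (par w))" using par[OF _ wr] Suc by auto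
      have nv: "par w \<noteq> v" using pw Suc by auto
      have "(par w, r) \<in> ?F\<^sup>*" using Suc pw nv arcs by (intro Suc.hyps) auto
      moreover have "(w, par w) \<in> ?F" using pw nv Suc.prems by auto
      ultimately show ?case by (rule converse_rtrancl_into_rtrancl[rotated])
    qed
    have V: "p \<in> V" "q \<in> V" using that arcs by auto
    have "p \<noteq> v" "q \<noteq> v" using that irr by auto
    then have "(q, r) \<in> ?F\<^sup>*" "(p, r) \<in> ?F\<^sup>*" using down V that by auto
    moreover have "(v, q) \<in> ?F" using that pq \<open>p \<noteq> v\<close> by auto
    moreover have "(r, p) \<in> ?F\<^sup>*" using \<open>(p, r) \<in> ?F\<^sup>*\<close> symF by (metis sym_rtrancl symD)
    ultimately have "(v, p) \<in> ?F\<^sup>*" by (meson converse_rtrancl_into_rtrancl rtrancl_trans)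
    then show False using bridge that by blast
  qed
  have edge: "u = par v \<and> v \<noteq> r \<or> v = par u \<and> u \<noteq> r" if uv: "(u, v) \<in> E" for u v
  proof -
    have *: "a = par b \<and> b \<noteq> r" if ab: "(a, b) \<in> E" "lev a \<le> lev b" for a b
    proof -
      have V: "a \<in> V" "b \<in> V" using ab arcs by auto
      have br: "b \<noteq> r" using ab lev_r lev0 V irr by (metis le_zero_eq)
      have "(b, a) \<in> E" using ab sym by (auto dest: symD)
      then show ?thesis using uniq[of b a "par b"] par[OF V(2) br] ab br by auto
    qed
    show ?thesis using *[of u v] *[of v u] uv sym by (metis nle_le symD)
  qed
  have "diam_tree V E r lev par x"
  proof
    show "\<exists>k\<le>lev x. (v, x) \<in> E ^^ k" if "v \<in> V" for v
      using mx[OF that xV] dst_walk[OF that xV] by (auto simp: lev_def)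
    show "lev v \<le> lev x" if "v \<in> V" for v using mx[OF rV that] by (simp add: lev_def)
  qed (use finV arcs sym rV xV lev_r par edge in \<open>auto dest: symD\<close>)
  then show ?thesis by (rule that)
qed

section \<open>Dominating sets from level classes\<close>

lemma sum_card_fibres:
  assumes "finite A" "finite I" "\<And>a. a \<in> A \<Longrightarrow> f a \<in> I"
  shows "(\<Sum>i\<in>I. card {a \<in> A. f a = i}) = card A"
proof -
  have "(\<Sum>i\<in>I. \<Sum>a\<in>{a \<in> A. f a = i}. 1) = (\<Sum>a\<in>A. 1 :: nat)"
    using assms by (intro sum.group) auto
  then show ?thesis by simp
qed

context diam_tree
begin

text \<open>Think of each leaf other than \<open>r\<close> as continued by \<open>t\<close> virtual
  vertices below it, and of \<open>r\<close> as continued by \<open>t\<close> virtual vertices above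
  it, whose levels \<open>-t, ..., -1\<close> have the residues \<open>d + 1, ..., d + t\<close>.
  The class collects all vertices of residue \<open>i\<close>, a virtual one being represented by
  its leaf or by \<open>r\<close>.\<close>

definition level_class :: "nat \<Rightarrow> nat \<Rightarrow> nat \<Rightarrow> 'a set" where
  "level_class t d i = {v \<in> V. lev v mod (d + 1 + t) = i} \<union>
     {v \<in> leaf_set V E - {r}. \<exists>s\<in>{1..t}. (lev v + s) mod (d + 1 + t) = i} \<union>
     (if d < i then {r} else {})"

lemma root_child:
  assumes "(v, r) \<in> E \<or> v \<in> V \<and> lev v = 1"
  shows "(r, v) \<in> E" "lev v = 1"
proof -
  have "(r, v) \<in> E \<and> lev v = 1"
  proof (cases "(v, r) \<in> E")
    case True
    then show ?thesis using symE edge_lev[OF True] lev_root by auto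
  next
    case False
    then have v: "v \<in> V" "lev v = 1" using assms by auto
    then have "v \<noteq> r" using lev_root by auto
    then have "(v, par v) \<in> E" "lev (par v) = 0" using par_edge lev_par v by auto
    then have "par v = r" using lev_eq_0 arcs_in by blast
    then show ?thesis using \<open>(v, par v) \<in> E\<close> symE v by auto
  qed
  then show "(r, v) \<in> E" "lev v = 1" by auto
qed

lemma has_child:
  assumes "v \<in> V" "lev x \<noteq> 0" "v = r \<or> v \<notin> leaf_set V E"
  shows "\<exists>c\<in>V. (v, c) \<in> E \<and> lev c = Suc (lev v)"
proof (cases "v = r")
  case True
  have "anc 1 x \<in> V" "lev (anc 1 x) = 1" using anc_facts[OF x_in, of 1] assms by auto
  then show ?thesis using root_child True lev_root by auto
next
  case False
  then obtain c where "(v, c) \<in> E" "\<not> lev c < lev v" using leaf_iff[OF assms(1)] assms by blast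
  then show ?thesis using edge_lev[of v c] arcs_in by auto
qed

text \<open>Adjacent vertices are one level apart and a leaf enters with a shift of at most
  \<open>t\<close>, so the levels responsible for their membership differ by a number from 1 to
  \<open>t + 1\<close>, which is less than the modulus. The extra membership of \<open>r\<close> is
  treated apart.\<close>

lemma level_class_indep:
  assumes "2 \<le> d" "t \<le> d" "d \<le> lev x" "i < d + 1 + t"
    and "u \<in> level_class t d i" "v \<in> level_class t d i"
  shows "(u, v) \<notin> E"
proof -
  let ?M = "d + 1 + t"
  have *: False if uv: "(u, v) \<in> E" "lev v = Suc (lev u)"
    and u: "u \<in> level_class t d i" and v: "v \<in> level_class t d i" for u v
  proof -
    have "u \<in> V" using uv arcs_in by auto
    have ul: "u = r" if "u \<in> leaf_set V E"
      using leaf_iff[of u] uv that \<open>u \<in> V\<close> by force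
    have vr: "v \<noteq> r" using uv lev_root by auto
    have u': "lev u mod ?M = i \<or> u = r \<and> d < i"
      using u ul by (auto simp: level_class_def split: if_splits)
    have v': "lev v mod ?M = i \<or> v \<in> leaf_set V E \<and> (\<exists>s\<in>{1..t}. (lev v + s) mod ?M = i)"
      using v vr by (auto simp: level_class_def split: if_splits)
    have shift: "(lev u + s) mod ?M \<noteq> lev u mod ?M" if "0 < s" "s < ?M" for s
    proof
      assume "(lev u + s) mod ?M = lev u mod ?M"
      then have "?M dvd s" by (simp add: mod_eq_dvd_iff_nat)
      then show False using that by (auto dest: dvd_imp_le)
    qed
    show False
    proof (cases "lev v mod ?M = i")
      case True
      then show False using u' shift[of 1] uv lev_root assms by auto
    next
      case False
      then obtain s where s: "v \<in> leaf_set V E" "1 \<le> s" "s \<le> t" "(lev v + s) mod ?M = i"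
        using v' by auto
      have "lev u mod ?M \<noteq> i" using s shift[of "Suc s"] uv assms(1) by auto
      then have "u = r" using u' by auto
      have lv: "lev v = 1" using \<open>u = r\<close> uv lev_root by auto
      \<comment> \<open>\<open>v\<close> is the only neighbour of \<open>r\<close>, so it lies on
        the longest path, whose length is at least 2. Thus it has a child and is no leaf.\<close>
      let ?y = "anc 2 x"
      have y: "?y \<in> V" "lev ?y = 2" using anc_facts[OF x_in, of 2] assms by auto
      then have "?y \<noteq> r" using lev_root by auto
      then have p: "(?y, par ?y) \<in> E" "lev (par ?y) = 1" using par_edge lev_par y by auto
      then have "(r, par ?y) \<in> E" using root_child arcs_in by auto
      moreover have "r \<in> leaf_set V E" using root_leaf assms by auto
      ultimately have "v = par ?y"
        using uv \<open>u = r\<close> by (auto dest: leaf_unique)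
      then show False using p symE leaf_iff[of v] s vr y lv arcs_in by fastforce
    qed
  qed
  show ?thesis using *[of u v] *[of v u] edge_lev[of u v] symE[of u v] assms by auto
qed

text \<open>If a level of residue \<open>i\<close> comes within \<open>t\<close> levels below
  \<open>w\<close>, descend to it; a leaf met earlier is itself in the class. Otherwise the previous
  such level is at most \<open>d\<close> levels above \<open>w\<close>; where it would be negative,
  a vertex of the longest path or \<open>r\<close> takes over.\<close>

lemma level_class_dom:
  assumes "2 \<le> d" "t \<le> d" "d \<le> lev x" "i < d + 1 + t" "w \<in> V"
  shows "\<exists>u\<in>level_class t d i. \<exists>k\<le>d. (w, u) \<in> E ^^ k"
proof -
  let ?M = "d + 1 + t"
  have x0: "lev x \<noteq> 0" using assms by auto
  have down: "\<exists>u\<in>level_class t d i. \<exists>k\<le>s. (w, u) \<in> E ^^ k"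
    if "w \<in> V" "(lev w + s) mod ?M = i" "s \<le> t" for s w
    using that
  proof (induction s arbitrary: w)
    case 0
    then show ?case by (intro bexI[of _ w] exI[of _ 0]) (auto simp: level_class_def)
  next
    case (Suc s)
    show ?case
    proof (cases "w = r \<or> w \<notin> leaf_set V E")
      case True
      then obtain c where c: "c \<in> V" "(w, c) \<in> E" "lev c = Suc (lev w)"
        using has_child Suc.prems x0 by blast
      then obtain u k where "u \<in> level_class t d i" "k \<le> s" "(c, u) \<in> E ^^ k"
        using Suc.IH[of c] Suc.prems by auto
      moreover have "(w, u) \<in> E ^^ Suc k" using c calculation by (blast intro: relpow_Suc_I2)
      ultimately show ?thesis by (meson Suc_le_mono)
    next
      case False
      then have "w \<in> level_class t d i" using Suc.prems
        by (auto simp: level_class_def intro!: bexI[of _ "Suc s"])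
      then show ?thesis by (intro bexI[of _ w] exI[of _ 0]) auto
    qed
  qed
  \<comment> \<open>The number of levels down to the next level of residue \<open>i\<close>; adding
    \<open>?M\<close> keeps the difference from being truncated.\<close>
  define s where "s = (i + (?M - lev w mod ?M)) mod ?M"
  have sM: "s < ?M" by (simp add: s_def)
  have "(lev w + s) mod ?M = (lev w mod ?M + (i + (?M - lev w mod ?M))) mod ?M"
    unfolding s_def by (metis mod_add_eq mod_mod_trivial)
  also have "lev w mod ?M + (i + (?M - lev w mod ?M)) = i + ?M"
    using mod_less_divisor[of ?M "lev w"] by linarith
  finally have s: "(lev w + s) mod ?M = i" using assms by (simp only: mod_add_self2 mod_less)
  show ?thesis
  proof (cases "s \<le> t")
    case True
    then show ?thesis using down[OF assms(5) s] assms(2) by (meson order_trans)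
  next
    case False
    \<comment> \<open>The number of levels up to the previous level of residue \<open>i\<close>;
      \<open>t < s\<close> gives \<open>q \<le> d\<close>.\<close>
    define q where "q = ?M - s"
    have q: "q \<le> d" "0 < q" "s + q = ?M" using False sM by (auto simp: q_def)
    show ?thesis
    proof (cases "q \<le> lev w")
      case True
      let ?a = "anc (lev w - q) w"
      have a: "?a \<in> V" "lev ?a = lev w - q" "(w, ?a) \<in> E ^^ q"
        using anc_facts[OF assms(5), of "lev w - q"] True by auto
      have "(lev w - q) mod ?M = (lev w - q + ?M) mod ?M" by (simp only: mod_add_self2)
      also have "lev w - q + ?M = lev w + s" using True q by linarith
      finally have "?a \<in> level_class t d i" using a s by (auto simp: level_class_def)
      then show ?thesis using a q by blast
    next
      case False
      \<comment> \<open>Here \<open>lev w + s < ?M\<close>, so nothing is reduced.\<close>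
      then have i: "i = lev w + s" using s q by auto
      show ?thesis
      proof (cases "i \<le> d")
        case True
        have "anc i x \<in> level_class t d i"
          using anc_facts[OF x_in, of i] True assms by (auto simp: level_class_def)
        moreover obtain j where "j \<le> i" "(w, anc i x) \<in> E ^^ j"
          using walk_to_diam[of w i] i True assms by auto
        ultimately show ?thesis using True by (meson order_trans)
      next
        case False': False
        then have "r \<in> level_class t d i" by (auto simp: level_class_def)
        moreover have "anc 0 w = r" using anc_facts[OF assms(5), of 0] lev_eq_0 by auto
        then have "(w, r) \<in> E ^^ lev w" using anc_facts(3)[OF assms(5), of 0] by auto
        ultimately show ?thesis using False q by (intro bexI[of _ r] exI[of _ "lev w"]) auto
      qed
    qed
  qed
qed

lemma level_class_indep_dom:
  assumes "2 \<le> d" "t \<le> d" "d \<le> lev x" "i < d + 1 + t"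
  shows "indep_dom d V E (level_class t d i)"
proof -
  have "level_class t d i \<subseteq> V" using root_in by (auto simp: level_class_def leaf_set_def)
  then show ?thesis using level_class_indep level_class_dom assms unfolding indep_dom_def by blast
qed

text \<open>A vertex has one residue, each leaf other than \<open>r\<close> enters at most
  \<open>t\<close> further times, and \<open>r\<close> once for each of the \<open>t\<close>
  residues above \<open>d\<close>. Overlaps only lower the sum.\<close>

lemma sum_card_level_class:
  assumes "1 \<le> d" "t \<le> d" "d \<le> lev x"
  shows "(\<Sum>i<d + 1 + t. card (level_class t d i)) \<le> card V + t * card (leaf_set V E)"
proof -
  let ?M = "d + 1 + t" and ?L = "leaf_set V E - {r}"
  have finL: "finite ?L" using finV by (auto simp: leaf_set_def)
  have rl: "r \<in> leaf_set V E" using root_leaf assms by auto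
  let ?A = "\<lambda>i. {v \<in> V. lev v mod ?M = i}"
  let ?B = "\<lambda>i s. {v \<in> ?L. (lev v + s) mod ?M = i}"
  have "card (level_class t d i) \<le> card (?A i) + (\<Sum>s\<in>{1..t}. card (?B i s)) + (if d < i then 1 else 0)"
    for i
  proof -
    have eq: "level_class t d i = ?A i \<union> (\<Union>s\<in>{1..t}. ?B i s) \<union> (if d < i then {r} else {})"
      by (auto simp: level_class_def)
    have "card (\<Union>s\<in>{1..t}. ?B i s) \<le> (\<Sum>s\<in>{1..t}. card (?B i s))"
      by (rule card_UN_le) simp
    moreover have "card (?A i \<union> (\<Union>s\<in>{1..t}. ?B i s)) \<le> card (?A i) + card (\<Union>s\<in>{1..t}. ?B i s)"
      by (rule card_Un_le)
    moreover have "card (level_class t d i) \<le>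
        card (?A i \<union> (\<Union>s\<in>{1..t}. ?B i s)) + card (if d < i then {r} else {})"
      unfolding eq by (rule card_Un_le)
    ultimately show ?thesis by (auto split: if_splits)
  qed
  then have "(\<Sum>i<?M. card (level_class t d i)) \<le>
      (\<Sum>i<?M. card (?A i) + (\<Sum>s\<in>{1..t}. card (?B i s)) + (if d < i then 1 else 0))"
    by (intro sum_mono) simp
  also have "\<dots> = (\<Sum>i<?M. card (?A i)) + (\<Sum>s\<in>{1..t}. \<Sum>i<?M. card (?B i s)) +
      (\<Sum>i<?M. if d < i then 1 else 0)"
    by (simp only: sum.distrib sum.swap[of _ "{1..t}"])
  also have "(\<Sum>i<?M. card (?A i)) = card V"
    by (rule sum_card_fibres) (auto simp: finV)
  also have "(\<Sum>s\<in>{1..t}. \<Sum>i<?M. card (?B i s)) = (\<Sum>s\<in>{1..t}. card ?L)"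
    by (intro sum.cong sum_card_fibres refl finL) auto
  also have "\<dots> = t * (card (leaf_set V E) - 1)"
    using rl by (simp add: card_Diff_singleton)
  also have "(\<Sum>i<?M. if d < i then 1 else 0 :: nat) = card {i \<in> {..<?M}. d < i}"
    by (subst sum.inter_filter[symmetric]) simp_all
  also have "{i \<in> {..<?M}. d < i} = {d<..<?M}" by auto
  also have "card {d<..<?M} = t" by simp
  finally have "(\<Sum>i<?M. card (level_class t d i)) \<le> card V + t * (card (leaf_set V E) - 1) + t" .
  moreover have "card (leaf_set V E) \<noteq> 0" using rl finV by (auto simp: leaf_set_def)
  then have "t * (card (leaf_set V E) - 1) + t = t * card (leaf_set V E)"
    by (cases "card (leaf_set V E)") auto
  ultimately show ?thesis by linarith
qed

lemma centre_indep_dom: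
  assumes "lev x \<le> d"
  shows "indep_dom d V E {x}"
proof -
  have "\<exists>k\<le>d. (v, x) \<in> E ^^ k" if "v \<in> V" for v
    using walk_to_x[OF that] assms order_trans by blast
  then show ?thesis using no_loop x_in by (simp add: indep_dom_def)
qed

lemma two_leaves:
  assumes "lev x \<noteq> 0"
  shows "2 \<le> card (leaf_set V E)"
proof -
  have "card {r, x} \<le> card (leaf_set V E)"
    using root_leaf x_leaf assms finV by (intro card_mono) (auto simp: leaf_set_def)
  then show ?thesis using x_leaf assms by auto
qed

text \<open>
  The witnesses are the ancestors of \<open>q\<close> and a child of \<open>q\<close>; if \<open>q\<close> has too few ancestors, vertices of
  the longest path take their place. The one of level \<open>e + 1\<close> is within \<open>e + 1\<close> of the child, so within \<open>e\<close> of \<open>q\<close>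
  unless it lies below \<open>q\<close>, where it is within \<open>e\<close> of \<open>q\<close> as well.
\<close>

lemma near_level_classes:
  assumes "q \<in> V" "q \<noteq> r" "q \<notin> leaf_set V E" "e < d" "d \<le> lev x" "0 < e"
  shows "e + 2 \<le> card {i. i < d + 1 \<and> (\<exists>u\<in>level_class 0 d i. \<exists>j\<le>e. (q, u) \<in> E ^^ j)}"
    (is "_ \<le> card ?I")
proof -
  have fin: "finite ?I" by simp
  have mem: "lev u mod (d + 1) \<in> ?I" if "u \<in> V" "(q, u) \<in> E ^^ j" "j \<le> e" for u j
    using that by (auto simp: level_class_def)
  obtain c where c: "c \<in> V" "(q, c) \<in> E" "lev c = Suc (lev q)"
    using has_child assms by (metis not_less_eq not_less_zero le_zero_eq)
  have up: "i mod (d + 1) \<in> ?I" if "i \<le> lev q" "lev q \<le> i + e" for i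
    using mem[of "anc i q" "lev q - i"] anc_facts[OF assms(1) that(1)] that by auto
  have cI: "Suc (lev q) mod (d + 1) \<in> ?I"
    using mem[of c 1] c assms by auto
  have *: "card J \<le> card ?I" if "inj_on (\<lambda>i. i mod (d + 1)) J" "(\<lambda>i. i mod (d + 1)) ` J \<subseteq> ?I" for J
    using card_inj_on_le[OF that fin] .
  show ?thesis
  proof (cases "e \<le> lev q")
    case True
    \<comment> \<open>These are \<open>e + 2 \<le> d + 1\<close> consecutive levels, so their
      residues are distinct.\<close>
    let ?J = "{lev q - e..Suc (lev q)}"
    have "inj_on (\<lambda>i. i mod (d + 1)) ?J"
    proof (rule linorder_inj_onI)
      fix a b assume ab: "a < b" "a \<in> ?J" "b \<in> ?J"
      then have b: "b - a < d + 1" "0 < b - a" using assms True by auto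
      show "a mod (d + 1) \<noteq> b mod (d + 1)"
      proof
        assume "a mod (d + 1) = b mod (d + 1)"
        then have "d + 1 dvd b - a" using ab by (metis mod_eq_dvd_iff_nat less_imp_le)
        then show False using b by (auto dest: dvd_imp_le)
      qed
    qed auto
    moreover have "(\<lambda>i. i mod (d + 1)) ` ?J \<subseteq> ?I"
    proof
      fix m assume "m \<in> (\<lambda>i. i mod (d + 1)) ` ?J"
      then obtain i where i: "m = i mod (d + 1)" "lev q - e \<le> i" "i \<le> Suc (lev q)" by auto
      show "m \<in> ?I"
      proof (cases "i = Suc (lev q)")
        case False
        then show ?thesis using up[of i] i True by auto
      qed (use cI i in simp)
    qed
    ultimately have "card ?J \<le> card ?I" by (rule *)
    then show ?thesis using True by simp
  next
    case False
    let ?J = "{0..Suc e}"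
    have sm: "i mod (d + 1) = i" if "i \<in> ?J" for i using that assms by auto
    have "inj_on (\<lambda>i. i mod (d + 1)) ?J" using sm by (auto simp: inj_on_def)
    moreover have "i mod (d + 1) \<in> ?I" if i: "i \<in> ?J" for i
    proof (cases "i \<le> lev q")
      case True
      then show ?thesis using up[of i] False by auto
    next
      case gt: False
      have ix: "i \<le> lev x" using i assms by auto
      have y: "anc i x \<in> V" "lev (anc i x) = i" using anc_facts[OF x_in ix] by auto
      have "\<exists>j\<le>e. (q, anc i x) \<in> E ^^ j"
      proof (cases "i \<le> e")
        case True
        then show ?thesis
          using walk_to_diam[of q i] assms(1) gt ix order_trans[of _ i e] by (metis nle_le)
      next
        case False': False
        then have ie: "i = Suc e" using i by auto
        obtain j where j: "j \<le> i" "(c, anc i x) \<in> E ^^ j"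
          using walk_to_diam[of c i] c gt ix by auto
        have acq: "anc (lev q) c = q" using anc_edge[OF c(2), of "lev q"] c anc_self by auto
        from walk_from_subtree[OF j(2), of "lev q"] c acq
        consider j' where "(q, anc i x) \<in> E ^^ j'" "j' + 1 \<le> j"
          | "anc (lev q) (anc i x) = q" by auto
        then show ?thesis
        proof cases
          case 1
          then show ?thesis using j ie by (intro exI[of _ j']) auto
        next
          case 2
          then have "(anc i x, q) \<in> E ^^ (i - lev q)"
            using anc_facts(3)[OF y(1), of "lev q"] y gt by auto
          then have "(q, anc i x) \<in> E ^^ (i - lev q)"
            using relpow_converse_sym[of E] symE by (metis symI)
          \<comment> \<open>As \<open>q\<close> is not the root,
            \<open>Suc e - lev q \<le> e\<close>.\<close>
          moreover have "lev q \<noteq> 0" using lev_eq_0 assms by auto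
          ultimately show ?thesis using ie by (intro exI[of _ "i - lev q"]) auto
        qed
      qed
      then show ?thesis using mem[OF y(1)] y by auto
    qed
    then have "(\<lambda>i. i mod (d + 1)) ` ?J \<subseteq> ?I" by blast
    ultimately have "card ?J \<le> card ?I" by (rule *)
    then show ?thesis by simp
  qed
qed

end

section \<open>Pendant paths\<close>

text \<open>Neighbourhoods are prescribed for \<open>i < k\<close> only, so the rest of the tree can
  be attached at \<open>f k\<close> alone.\<close>

definition pendant :: "'a set \<Rightarrow> ('a \<times> 'a) set \<Rightarrow> (nat \<Rightarrow> 'a) \<Rightarrow> nat \<Rightarrow> bool" where
  "pendant V E f k \<longleftrightarrow> f ` {..k} \<subseteq> V \<and> inj_on f {..k} \<and>
     (\<forall>i<k. E `` {f i} = (if i = 0 then {f 1} else {f (i - 1), f (i + 1)}))"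

text \<open>Serves to exclude configurations: a set closed under neighbours is the whole tree, hence
  cannot be too small.\<close>

lemma utree_closed_set:
  assumes "utree V E" "U \<subseteq> V" "U \<noteq> {}" "E `` U \<subseteq> U"
  shows "U = V"
proof -
  obtain u where u: "u \<in> U" using assms by auto
  have "v \<in> U" if "v \<in> V" for v
  proof -
    have "(u, v) \<in> E\<^sup>*" using assms u that by (auto simp: utree_def)
    then show ?thesis by (induction rule: rtrancl_induct) (use u assms in auto)
  qed
  then show ?thesis using assms by auto
qed

lemma utree_no_loop: "utree V E \<Longrightarrow> (v, v) \<notin> E"
  by (auto simp: utree_def)

lemma utree_finite_nbrs: "utree V E \<Longrightarrow> finite (E `` {v})"
  by (rule finite_subset[of _ V]) (auto simp: utree_def)

lemma pendant_nbrs: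
  assumes "pendant V E f k" "i < k"
  shows "E `` {f i} = (if i = 0 then {f 1} else {f (i - 1), f (i + 1)})"
  using assms by (auto simp: pendant_def)

lemma pendant_step:
  assumes "pendant V E f k" "i < k"
  shows "(f i, f (Suc i)) \<in> E"
  using pendant_nbrs[OF assms] by (auto split: if_splits)

lemma pendant_edge_cases:
  assumes "pendant V E f k" "i < k" "(f i, y) \<in> E"
  shows "y = f (Suc i) \<or> 0 < i \<and> y = f (i - 1)"
  using pendant_nbrs[OF assms(1,2)] assms(3) by (auto split: if_splits)

lemma pendant_inj:
  assumes "pendant V E f k" "i \<le> k" "j \<le> k"
  shows "f i = f j \<longleftrightarrow> i = j"
  using assms by (auto simp: pendant_def inj_on_def)

lemma pendant_end_nbr:
  assumes "utree V E" "pendant V E f k" "0 < k"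
  shows "f (k - 1) \<in> E `` {f k}"
  using pendant_step[OF assms(2), of "k - 1"] assms by (auto simp: utree_def dest: symD)

lemma pendant_boundary:
  assumes "pendant V E f k" "a \<in> f ` {..<k}" "(a, b) \<in> E" "b \<notin> f ` {..<k}"
  shows "b = f k \<and> a = f (k - 1)"
proof -
  obtain i where i: "i < k" "a = f i" using assms by auto
  then have b: "b = f (Suc i)" using pendant_edge_cases[OF assms(1), of i b] assms by auto
  then have "\<not> Suc i < k" using assms by auto
  then show ?thesis using i b by (metis Suc_lessI diff_Suc_1)
qed

lemma pendant_walk_up:
  assumes "pendant V E f k"
  shows "i + j \<le> k \<Longrightarrow> (f i, f (i + j)) \<in> E ^^ j"
proof (induction j)
  case (Suc j)
  then show ?case using pendant_step[OF assms, of "i + j"] by auto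
qed simp

lemma pendant_walk_from_start:
  assumes "pendant V E f k" "(f 0, u) \<in> E ^^ j" "j \<le> k"
  shows "u \<in> f ` {..j}"
  using assms(2,3)
proof (induction j arbitrary: u)
  case (Suc j)
  then obtain w where w: "(f 0, w) \<in> E ^^ j" "(w, u) \<in> E" by auto
  then obtain i where i: "i \<le> j" "w = f i" using Suc by fastforce
  then have "u = f (Suc i) \<or> 0 < i \<and> u = f (i - 1)"
    using pendant_edge_cases[OF assms(1), of i u] w Suc.prems by auto
  then show ?case using i by auto
qed simp

text \<open>The interior of the path is entered only through \<open>f k\<close>. So seen from
  outside, \<open>f k\<close> dominates at least as well as any interior vertex.\<close>

lemma pendant_walk_enter:
  assumes T: "utree V E" and p: "pendant V E f k" and v: "v \<notin> f ` {..<k}"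
  shows "(v, u) \<in> E ^^ j \<Longrightarrow> u \<in> f ` {..<k} \<Longrightarrow> \<exists>j'\<le>j. (v, f k) \<in> E ^^ j'"
proof (induction j arbitrary: u)
  case 0
  then show ?case using v by auto
next
  case (Suc j)
  then obtain w where w: "(v, w) \<in> E ^^ j" "(w, u) \<in> E" by auto
  show ?case
  proof (cases "w \<in> f ` {..<k}")
    case True
    then show ?thesis using Suc.IH[OF w(1)] le_SucI by blast
  next
    case False
    have "(u, w) \<in> E" using w T by (auto simp: utree_def dest: symD)
    then have "w = f k" using pendant_boundary[OF p Suc.prems(2) _ False] by auto
    then show ?thesis using w by (intro exI[of _ j]) auto
  qed
qed

lemma pendant_closed:
  assumes T: "utree V E" and p: "pendant V E f k" and k: "0 < k" and deg: "card (E `` {f k}) = 1"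
  shows "V = f ` {..k}"
proof -
  have "f k \<in> leaf_set V E" using p deg by (auto simp: leaf_set_def pendant_def)
  then have "E `` {f k} = {f (k - 1)}"
    using pendant_end_nbr[OF T p k] leaf_unique[of "f k" V E] by blast
  then have "E `` (f ` {..k}) \<subseteq> f ` {..k}"
  proof -
    have "y \<in> f ` {..k}" if "i \<le> k" "(f i, y) \<in> E" for i y
    proof (cases "i = k")
      case True
      then show ?thesis using that \<open>E `` {f k} = {f (k - 1)}\<close> by auto
    next
      case False
      then have "i < k" using that by auto
      then show ?thesis using pendant_edge_cases[OF p \<open>i < k\<close> that(2)] by auto
    qed
    then show ?thesis by auto
  qed
  then show ?thesis using utree_closed_set[OF T, of "f ` {..k}"] p by (auto simp: pendant_def)
qed

lemma pendant_extend:
  assumes T: "utree V E" and p: "pendant V E f k" and k: "0 < k" and deg: "card (E `` {f k}) = 2"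
  shows "\<exists>g. g 0 = f 0 \<and> pendant V E g (Suc k)"
proof -
  have sy: "sym E" and arcs: "E \<subseteq> V \<times> V" using T by (auto simp: utree_def)
  have q: "f (k - 1) \<in> E `` {f k}" using pendant_end_nbr[OF T p k] .
  then have "card (E `` {f k} - {f (k - 1)}) = 1" using deg by (simp add: card_Diff_singleton)
  then obtain y where "E `` {f k} - {f (k - 1)} = {y}" by (auto simp: card_1_singleton_iff)
  then have y: "E `` {f k} = {f (k - 1), y}" "y \<noteq> f (k - 1)" using q by blast+
  \<comment> \<open>Among the \<open>f i\<close> with \<open>i < k\<close>, only
    \<open>f (k - 1)\<close> is adjacent to \<open>f k\<close>.\<close>
  have new: "y \<noteq> f i" if "i \<le> k" for i
  proof
    assume yi: "y = f i"
    have e: "(f i, f k) \<in> E" using y yi sy by (auto dest: symD)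
    then have "i \<noteq> k" using utree_no_loop[OF T] by auto
    then have ik: "i < k" using that by auto
    have "f k = f (Suc i) \<or> 0 < i \<and> f k = f (i - 1)" using pendant_edge_cases[OF p ik e] .
    then have "k = Suc i" using pendant_inj[OF p, of k] ik by auto
    then show False using y yi by auto
  qed
  define g where "g i = (if i \<le> k then f i else y)" for i
  have "y \<in> V" using y arcs by auto
  moreover have "inj_on g {..Suc k}"
    using p new by (auto simp: inj_on_def g_def pendant_def le_Suc_eq)
  moreover have "E `` {g i} = (if i = 0 then {g 1} else {g (i - 1), g (i + 1)})" if "i < Suc k" for i
  proof (cases "i = k")
    case True
    then show ?thesis using y k by (auto simp: g_def)
  next
    case False
    then show ?thesis using pendant_nbrs[OF p, of i] that k by (auto simp: g_def)
  qed
  ultimately have "pendant V E g (Suc k)" using p by (auto simp: pendant_def g_def)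
  then show ?thesis by (intro exI[of _ g]) (simp add: g_def)
qed

text \<open>The path is extended while its end has degree 2. An end of degree 1 would make it the
  whole tree, contrary to \<open>k < card V\<close>.\<close>

lemma pendant_from_leaf:
  assumes T: "utree V E" and z: "z \<in> leaf_set V E" and k: "1 \<le> k" "k < card V"
  shows "\<exists>f j. f 0 = z \<and> 1 \<le> j \<and> j \<le> k \<and> pendant V E f j \<and> (j < k \<longrightarrow> 3 \<le> card (E `` {f j}))"
  using k
proof (induction k rule: nat_induct_at_least)
  case base
  obtain y where y: "E `` {z} = {y}" using z by (auto simp: leaf_set_def card_1_singleton_iff)
  have "y \<in> V" "y \<noteq> z" "z \<in> V"
    using y T z utree_no_loop[OF T] by (auto simp: utree_def leaf_set_def)
  then have "pendant V E (\<lambda>i. if i = 0 then z else y) 1"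
    using y by (auto simp: pendant_def inj_on_def le_Suc_eq)
  then show ?case by (intro exI[of _ "\<lambda>i. if i = 0 then z else y"] exI[of _ 1]) auto
next
  case (Suc k)
  then obtain f j where f: "f 0 = z" "1 \<le> j" "j \<le> k" "pendant V E f j"
    "j < k \<longrightarrow> 3 \<le> card (E `` {f j})" by auto
  have "card (E `` {f j}) \<noteq> 0"
    using pendant_end_nbr[OF T f(4)] f(2) utree_finite_nbrs[OF T] by auto
  moreover have "card (E `` {f j}) \<noteq> 1"
  proof
    assume "card (E `` {f j}) = 1"
    then have "V = f ` {..j}" using pendant_closed[OF T f(4)] f(2) by auto
    then have "card V \<le> Suc j" using card_image_le[of "{..j}" f] by simp
    then show False using Suc.prems f by auto
  qed
  ultimately consider "3 \<le> card (E `` {f j})" | "card (E `` {f j}) = 2" "j = k" using f by linarith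
  then show ?case
  proof cases
    case 1
    then show ?thesis using f by (intro exI[of _ f] exI[of _ j]) auto
  next
    case 2
    then obtain g where "g 0 = f 0" "pendant V E g (Suc k)"
      using pendant_extend[OF T f(4)] f by auto
    then show ?thesis using f by (intro exI[of _ g] exI[of _ "Suc k"]) auto
  qed
qed

section \<open>Pruning a pendant path\<close>

locale pendant_path =
  fixes V :: "'a set" and E :: "('a \<times> 'a) set" and f :: "nat \<Rightarrow> 'a" and k :: nat
  assumes T: "utree V E" and p: "pendant V E f k" and kpos: "0 < k"
    and deg: "3 \<le> card (E `` {f k})"
begin

abbreviation P :: "'a set" where "P \<equiv> f ` {..<k}"
definition V' :: "'a set" where "V' = V - P"
definition E' :: "('a \<times> 'a) set" where "E' = E \<inter> V' \<times> V'"

lemma symE: "(u, v) \<in> E \<Longrightarrow> (v, u) \<in> E"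
  using T by (auto simp: utree_def dest: symD)

lemma arcs_in: "E \<subseteq> V \<times> V" and finV: "finite V"
  using T by (auto simp: utree_def)

lemma P_sub: "P \<subseteq> V"
  using p by (auto simp: pendant_def)

lemma q_in: "f k \<in> V'"
  using p pendant_inj[OF p] by (auto simp: V'_def pendant_def)

lemmas boundary = pendant_boundary[OF p]

lemma E'_sub: "E' \<subseteq> E"
  by (auto simp: E'_def)

lemma relpow_E': "(u, v) \<in> E' ^^ j \<Longrightarrow> (u, v) \<in> E ^^ j"
  by (induction j arbitrary: v) (use E'_sub in auto)

lemma utree': "utree V' E'"
proof -
  \<comment> \<open>The retraction of the path onto its end \<open>f k\<close> turns walks of the
    tree into walks of the pruned tree.\<close>
  define \<rho> where "\<rho> w = (if w \<in> P then f k else w)" for w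
  have "(u, v) \<in> E'\<^sup>*" if uv: "u \<in> V'" "v \<in> V'" for u v
  proof -
    have "(u, v) \<in> E\<^sup>*" using uv T by (auto simp: utree_def V'_def)
    then have "(u, \<rho> v) \<in> E'\<^sup>*"
    proof (induction rule: rtrancl_induct)
      case base
      then show ?case using uv by (simp add: \<rho>_def V'_def)
    next
      case (step w y)
      have "\<rho> w = \<rho> y \<or> (\<rho> w, \<rho> y) \<in> E'"
      proof (cases "w \<in> P"; cases "y \<in> P")
        assume "w \<notin> P" "y \<notin> P"
        then show ?thesis using step arcs_in by (auto simp: \<rho>_def E'_def V'_def)
      qed (use step boundary symE q_in in \<open>auto simp: \<rho>_def V'_def\<close>)
      then show ?case using step by (metis rtrancl.rtrancl_into_rtrancl)
    qed
    then show ?thesis using uv by (simp add: \<rho>_def V'_def)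
  qed
  moreover have "(u, v) \<notin> (E' - {(u, v), (v, u)})\<^sup>*" if "(u, v) \<in> E'" for u v
  proof -
    have "(E' - {(u, v), (v, u)})\<^sup>* \<subseteq> (E - {(u, v), (v, u)})\<^sup>*"
      using E'_sub by (intro rtrancl_mono) auto
    moreover have "(u, v) \<notin> (E - {(u, v), (v, u)})\<^sup>*"
      using that E'_sub T unfolding utree_def by blast
    ultimately show ?thesis by blast
  qed
  moreover have "sym E'" using symE by (auto simp: sym_def E'_def)
  ultimately show ?thesis using finV by (auto simp: utree_def V'_def E'_def)
qed

lemma card_V': "card V' + k = card V"
proof -
  have "card P = k" using p by (subst card_image) (auto simp: pendant_def inj_on_def)
  then show ?thesis using card_Diff_subset[of P V] P_sub finV card_mono[of V P]
    by (auto simp: V'_def)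
qed

lemma nbrs_other: "v \<in> V' \<Longrightarrow> v \<noteq> f k \<Longrightarrow> E' `` {v} = E `` {v}"
  using boundary symE arcs_in by (auto simp: E'_def V'_def)

lemma nbrs_end: "E' `` {f k} = E `` {f k} - {f (k - 1)}"
proof -
  have q: "f k \<notin> P" using q_in by (simp add: V'_def)
  have "E' `` {f k} = E `` {f k} - P"
    using arcs_in q_in by (auto simp: E'_def V'_def)
  moreover have "y = f (k - 1)" if "(f k, y) \<in> E" "y \<in> P" for y
    using boundary[OF that(2) symE[OF that(1)] q] by simp
  moreover have "f (k - 1) \<in> P" using kpos by auto
  ultimately show ?thesis by blast
qed

lemma card_nbrs_end: "card (E' `` {f k}) = card (E `` {f k}) - 1"
  unfolding nbrs_end using pendant_end_nbr[OF T p kpos] by (simp add: card_Diff_singleton)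

lemma end_not_leaf: "f k \<notin> leaf_set V' E'" "f k \<notin> leaf_set V E"
  using card_nbrs_end deg by (auto simp: leaf_set_def)

lemma start_leaf: "f 0 \<in> leaf_set V E"
  using pendant_nbrs[OF p kpos] p by (auto simp: leaf_set_def pendant_def)

text \<open>The removed vertices other than \<open>f 0\<close> have degree 2, and \<open>f k\<close>
  keeps degree at least 2. So pruning destroys one leaf and creates none.\<close>

lemma leaf_set': "leaf_set V' E' = leaf_set V E - {f 0}"
proof -
  have "f i \<notin> leaf_set V E" if "0 < i" "i < k" for i
    using pendant_nbrs[OF p, of i] pendant_inj[OF p, of "i - 1" "i + 1"] that
    by (auto simp: leaf_set_def)
  then have "leaf_set V E \<inter> P \<subseteq> {f 0}" by (auto simp: image_iff) (metis gr0I)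
  moreover have "f 0 \<in> P" using kpos by auto
  moreover have "v \<in> leaf_set V' E' \<longleftrightarrow> v \<in> leaf_set V E" if "v \<in> V'" for v
  proof (cases "v = f k")
    case False
    then show ?thesis using nbrs_other[OF that] that by (auto simp: leaf_set_def V'_def)
  qed (use end_not_leaf in simp)
  ultimately show ?thesis by (auto simp: leaf_set_def V'_def)
qed

lemma card_leaf_set': "card (leaf_set V' E') + 1 = card (leaf_set V E)"
  unfolding leaf_set' using start_leaf finV card_Suc_Diff1[of "leaf_set V E" "f 0"]
  by (simp add: leaf_set_def)

text \<open>The removed vertices are within distance \<open>k\<close> of \<open>f k\<close>, so a
  vertex within \<open>d - k\<close> of \<open>f k\<close> dominates them.\<close>

lemma extend_near:
  assumes S: "indep_dom d V' E' S" and u: "u \<in> S" "(f k, u) \<in> E' ^^ j" "j + k \<le> d"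
  shows "indep_dom d V E S"
proof -
  have "\<exists>u\<in>S. \<exists>k\<le>d. (v, u) \<in> E ^^ k" if "v \<in> V" for v
  proof (cases "v \<in> P")
    case True
    then obtain i where i: "i < k" "v = f i" by auto
    then have "(v, f k) \<in> E ^^ (k - i)" using pendant_walk_up[OF p, of i "k - i"] by auto
    then have "(v, u) \<in> E ^^ (k - i + j)" using relpow_E' u by (auto simp: relpow_add)
    then show ?thesis using u i by (intro bexI[of _ u] exI[of _ "k - i + j"]) auto
  next
    case False
    then have "v \<in> V'" using that by (simp add: V'_def)
    then show ?thesis using S relpow_E' unfolding indep_dom_def by blast
  qed
  moreover have "(a, b) \<notin> E" if "a \<in> S" "b \<in> S" for a b
    using S that unfolding indep_dom_def E'_def by blast
  ultimately show ?thesis using S unfolding indep_dom_def V'_def by blast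
qed

text \<open>If \<open>f k\<close> is not in \<open>S\<close>, the leaf \<open>f 0\<close> can be
  added: its neighbour is a removed vertex or \<open>f k\<close>, and it dominates the removed
  vertices since \<open>k \<le> d\<close>.\<close>

lemma extend:
  assumes S: "indep_dom d V' E' S" and kd: "k \<le> d"
  obtains S' where "indep_dom d V E S'" "card S' \<le> card S + 1"
proof (cases "f k \<in> S")
  case True
  then have "indep_dom d V E S" using extend_near[OF S True, of 0] kd by simp
  then show ?thesis using that by fastforce
next
  case False
  have SV: "S \<subseteq> V'" using S by (simp add: indep_dom_def)
  have f0: "f 0 \<in> P" using kpos by auto
  have "(f 0, b) \<notin> E" if "b \<in> S" for b
  proof
    assume "(f 0, b) \<in> E"
    then have "b = f k" using boundary[OF f0] that SV by (auto simp: V'_def)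
    then show False using False that by simp
  qed
  then have ind: "(a, b) \<notin> E" if "a \<in> insert (f 0) S" "b \<in> insert (f 0) S" for a b
    using that symE utree_no_loop[OF T] S unfolding indep_dom_def E'_def by blast
  have "\<exists>u\<in>insert (f 0) S. \<exists>k\<le>d. (v, u) \<in> E ^^ k" if "v \<in> V" for v
  proof (cases "v \<in> P")
    case True
    then obtain i where i: "i < k" "v = f i" by auto
    then have "(v, f 0) \<in> E ^^ i" using pendant_walk_up[OF p, of 0 i] relpow_converse_sym[of E] T
      by (auto simp: utree_def)
    then show ?thesis using i kd by (intro bexI[of _ "f 0"] exI[of _ i]) auto
  next
    case False
    then have "v \<in> V'" using that by (simp add: V'_def)
    then show ?thesis using S relpow_E' unfolding indep_dom_def by blast
  qed
  then have "indep_dom d V E (insert (f 0) S)"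
    using ind SV P_sub f0 unfolding indep_dom_def V'_def by blast
  moreover have "card (insert (f 0) S) \<le> card S + 1"
    using finV SV finite_subset[of S V'] by (simp add: card_insert_if V'_def)
  ultimately show ?thesis by (rule that)
qed

end

section \<open>Counting in the pruned tree\<close>

context pendant_path
begin

text \<open>If the pruned tree had smaller depth, one vertex would dominate it and at most two the
  whole tree. But the pruned tree has at least two leaves, and the whole tree one more.\<close>

lemma pruned_deep:
  assumes R: "diam_tree V' E' r lev par x" and kd: "k \<le> d"
    and min: "\<And>S. indep_dom d V E S \<Longrightarrow> card (leaf_set V E) \<le> card S"
  shows "d \<le> lev x" "r \<noteq> f k" "lev x \<noteq> 0"
proof -
  interpret R: diam_tree V' E' r lev par x by fact
  have "card (E' `` {f k}) \<noteq> 0" using card_nbrs_end deg by auto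
  then have "E' `` {f k} \<noteq> {}" by (metis card.empty)
  then obtain y where y: "(f k, y) \<in> E'" by blast
  have "f k \<in> V'" "y \<in> V'" using y R.arcs_in by auto
  then show x0: "lev x \<noteq> 0" using R.edge_lev[OF y] R.lev_le by fastforce
  then show "r \<noteq> f k" using R.root_leaf end_not_leaf by auto
  show "d \<le> lev x"
  proof (rule ccontr)
    assume "\<not> d \<le> lev x"
    then have "indep_dom d V' E' {x}" using R.centre_indep_dom by auto
    then obtain S where "indep_dom d V E S" "card S \<le> card {x} + 1" using extend kd by blast
    then have "card (leaf_set V E) \<le> 2" using min by fastforce
    moreover have "2 \<le> card (leaf_set V' E')" using R.two_leaves x0 by blast
    ultimately show False using card_leaf_set' by auto
  qed
qed

text \<open>Let \<open>l\<close> be the number of leaves of the whole tree. The \<open>d + 1\<close>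
  classes of the pruned tree have at least \<open>l - 1\<close> elements each, and at least
  \<open>d - k + 2\<close> of them have one more. The total is at least
  \<open>(d + 1) * l - k + 1\<close>, which exceeds the number of vertices of the pruned
  tree.\<close>

lemma pendant_not_short:
  assumes d: "2 \<le> d" and kd: "k < d"
    and cardV: "card V \<le> (d + 1) * card (leaf_set V E)"
    and min: "\<And>S. indep_dom d V E S \<Longrightarrow> card (leaf_set V E) \<le> card S"
  shows False
proof -
  let ?l = "card (leaf_set V E)"
  obtain r lev par x where R: "diam_tree V' E' r lev par x"
    using utree_diam_tree[OF utree'] q_in by blast
  interpret R: diam_tree V' E' r lev par x by fact
  have deep: "d \<le> lev x" "r \<noteq> f k" "lev x \<noteq> 0" using pruned_deep[OF R less_imp_le[OF kd] min] by auto
  \<comment> \<open>The residues whose class comes close enough to \<open>f k\<close> to dominate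
    the removed path without a new vertex.\<close>
  define I where "I = {i. i < d + 1 \<and> (\<exists>u\<in>R.level_class 0 d i. \<exists>j\<le>d - k. (f k, u) \<in> E' ^^ j)}"
  have cI: "d - k + 2 \<le> card I"
    unfolding I_def using q_in deep end_not_leaf kd d kpos by (intro R.near_level_classes) auto
  have low: "(?l - 1) + (if i \<in> I then 1 else 0) \<le> card (R.level_class 0 d i)" if i: "i < d + 1" for i
  proof -
    have S: "indep_dom d V' E' (R.level_class 0 d i)"
      using R.level_class_indep_dom[of d 0 i] d deep i by auto
    obtain S' where S': "indep_dom d V E S'" "card S' \<le> card (R.level_class 0 d i) + 1"
      using extend[OF S] kd by auto
    have "?l \<le> card (R.level_class 0 d i)" if iI: "i \<in> I"
    proof -
      obtain u j where "u \<in> R.level_class 0 d i" "(f k, u) \<in> E' ^^ j" "j \<le> d - k"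
        using iI unfolding I_def by blast
      then show ?thesis using min extend_near[OF S, of u j] kd by auto
    qed
    then show ?thesis using min[OF S'(1)] S'(2) card_leaf_set' by auto
  qed
  have "(\<Sum>i<d + 1. (?l - 1) + (if i \<in> I then 1 else 0)) \<le> (\<Sum>i<d + 1. card (R.level_class 0 d i))"
    using low by (intro sum_mono) auto
  also have "\<dots> \<le> card V'" using R.sum_card_level_class[of d 0] d deep by auto
  also have "(\<Sum>i<d + 1. (?l - 1) + (if i \<in> I then 1 else 0)) = (d + 1) * (?l - 1) + card ({..<d + 1} \<inter> I)"
    by (simp only: sum.distrib sum.If_cases[OF finite_lessThan]) simp
  also have "{..<d + 1} \<inter> I = I" by (auto simp: I_def)
  finally have "(d + 1) * (?l - 1) + (d - k + 2) + k \<le> (d + 1) * ?l"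
    using cI cardV card_V' by linarith
  moreover have "(d + 1) * ?l = (d + 1) * (?l - 1) + (d + 1)"
    using card_leaf_set' by (metis add_diff_cancel_right' distrib_left mult.right_neutral)
  ultimately show False using kd by linarith
qed

text \<open>
  \<open>S\<close> meets the second path or contains \<open>f d\<close>; replacing its part on the second path by \<open>f d\<close>
  dominates both paths without enlarging \<open>S\<close>.
\<close>

lemma twin_swap:
  assumes k: "k = d" and g: "pendant V E g d" "g d = f d" "g ` {..<d} \<inter> P = {}"
    and S: "indep_dom d V' E' S" and nb: "\<And>b. b \<in> S \<Longrightarrow> (f d, b) \<notin> E"
    and min: "\<And>S. indep_dom d V E S \<Longrightarrow> card (leaf_set V E) \<le> card S"
  shows "card (leaf_set V E) \<le> card S"
proof -
  let ?Q = "g ` {..<d}"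
  have SV: "S \<subseteq> V'" using S by (simp add: indep_dom_def)
  have finS: "finite S" using SV finV finite_subset[of S V'] by (simp add: V'_def)
  have QV: "?Q \<subseteq> V'" using g(1,3) by (auto simp: V'_def pendant_def)
  have d: "0 < d" using k kpos by simp
  have "g 0 \<in> V'" using QV d by auto
  then obtain u j where u: "u \<in> S" "j \<le> d" "(g 0, u) \<in> E' ^^ j"
    using S unfolding indep_dom_def by blast
  \<comment> \<open>At most \<open>d\<close> steps from \<open>g 0\<close> lead no further than
    \<open>g d\<close>, so the dominator of \<open>g 0\<close> is on the second path.\<close>
  have "u \<in> g ` {..j}" using pendant_walk_from_start[OF g(1) relpow_E'[OF u(3)] u(2)] .
  then have "u = f d \<or> u \<in> ?Q" using u(2) g(2) by (auto simp: le_less)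
  then show ?thesis
  proof
    assume "u = f d"
    then have "indep_dom d V E S" using extend_near[OF S u(1), of 0] k by simp
    then show ?thesis by (rule min)
  next
    assume uQ: "u \<in> ?Q"
    let ?S = "insert (f d) (S - ?Q)"
    have ind: "(a, b) \<notin> E" if "a \<in> ?S" "b \<in> ?S" for a b
      using that symE nb utree_no_loop[OF T] S unfolding indep_dom_def E'_def by blast
    have to_q: "\<exists>u\<in>?S. \<exists>k\<le>d. (v, u) \<in> E ^^ k" if "(v, f d) \<in> E ^^ j" "j \<le> d" for v j
      using that by blast
    have dom: "\<exists>u\<in>?S. \<exists>k\<le>d. (v, u) \<in> E ^^ k" if v: "v \<in> V" for v
    proof (cases "v \<in> P \<or> v \<in> ?Q")
      case True
      then obtain i where i: "i < d" "v = f i \<or> v = g i" using k by auto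
      then have "(v, f d) \<in> E ^^ (d - i)"
        using pendant_walk_up[OF p, of i "d - i"] pendant_walk_up[OF g(1), of i "d - i"] g(2) k
        by auto
      then show ?thesis by (rule to_q) simp
    next
      case False
      then have "v \<in> V'" using v by (simp add: V'_def)
      then obtain w j where w: "w \<in> S" "j \<le> d" "(v, w) \<in> E' ^^ j"
        using S unfolding indep_dom_def by blast
      show ?thesis
      proof (cases "w \<in> ?Q")
        case True
        then obtain j' where "j' \<le> j" "(v, g d) \<in> E ^^ j'"
          using pendant_walk_enter[OF T g(1) _ relpow_E'[OF w(3)]] False by blast
        then show ?thesis using to_q[of v j'] g(2) w(2) by auto
      next
        case False
        then show ?thesis using w relpow_E'[OF w(3)] by blast
      qed
    qed
    have "f d = f k" using k by simp
    then have "?S \<subseteq> V" using SV q_in by (auto simp: V'_def)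
    then have "indep_dom d V E ?S" using ind dom unfolding indep_dom_def by blast
    then have "card (leaf_set V E) \<le> card ?S" by (rule min)
    also have "card ?S \<le> Suc (card (S - ?Q))" using finS by (simp add: card_insert_if)
    also have "card (S - ?Q) < card S" using uQ u(1) finS by (intro psubset_card_mono) auto
    finally show ?thesis by linarith
  qed
qed

text \<open>Count with \<open>t = 1\<close>, and let \<open>l\<close> be the number of leaves of the
  whole tree. All \<open>d + 2\<close> classes of the pruned tree have at least \<open>l - 1\<close>
  elements, and all but at most two have at least \<open>l\<close>. The total is at least
  \<open>(d + 2) * (l - 1) + d\<close>, whereas it is at most
  \<open>(d + 1) * l - d + (l - 1)\<close>, which is smaller by \<open>d - 1\<close>.\<close>

lemma pendant_no_twin:
  assumes d: "2 \<le> d" and k: "k = d"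
    and g: "pendant V E g d" "g d = f d" "g ` {..<d} \<inter> P = {}"
    and leaf_nbrs: "\<And>z y. z \<in> leaf_set V E \<Longrightarrow> (z, y) \<in> E \<Longrightarrow> card (E `` {y}) = 2"
    and cardV: "card V \<le> (d + 1) * card (leaf_set V E)"
    and min: "\<And>S. indep_dom d V E S \<Longrightarrow> card (leaf_set V E) \<le> card S"
  shows False
proof -
  let ?l = "card (leaf_set V E)" and ?M = "d + 1 + 1"
  obtain r lev par x where R: "diam_tree V' E' r lev par x"
    using utree_diam_tree[OF utree'] q_in by blast
  interpret R: diam_tree V' E' r lev par x by fact
  have deep: "d \<le> lev x" "r \<noteq> f k" "lev x \<noteq> 0" using pruned_deep[OF R, of d] k min by auto
  have fdk: "f d = f k" using k by simp
  \<comment> \<open>The residues of the levels next to that of \<open>f d\<close>;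
    \<open>twin_swap\<close> applies to all other classes.\<close>
  define X where "X = {(lev (f d) + 1) mod ?M, (lev (f d) - 1) mod ?M}"
  have cX: "card X \<le> 2" unfolding X_def by (simp add: card_insert_if)
  have low: "(?l - 1) + (if i \<in> X then 0 else 1) \<le> card (R.level_class 1 d i)" if i: "i < ?M" for i
  proof -
    let ?S = "R.level_class 1 d i"
    have S: "indep_dom d V' E' ?S"
      using R.level_class_indep_dom[of d 1 i] d deep i by auto
    obtain S' where S': "indep_dom d V E S'" "card S' \<le> card ?S + 1"
      using extend[OF S] k by auto
    have "?l \<le> card ?S" if iX: "i \<notin> X"
    proof (rule twin_swap[OF k g S _ min])
      fix b assume b: "b \<in> ?S"
      show "(f d, b) \<notin> E"
      proof
        assume e: "(f d, b) \<in> E"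
        have "b \<in> V'" using b S by (auto simp: indep_dom_def)
        then have e': "(f d, b) \<in> E'" using e q_in fdk by (simp add: E'_def)
        \<comment> \<open>Neighbours of leaves have degree 2, so \<open>f d\<close> is adjacent to
          no leaf. Hence \<open>b\<close> belongs to the class because of its level.\<close>
        have "b \<notin> leaf_set V E" using leaf_nbrs[of b "f d"] symE[OF e] deg fdk by auto
        then have nl: "b \<notin> leaf_set V' E'" by (simp add: leaf_set')
        then have "lev b mod ?M = i"
          using b R.root_leaf deep by (auto simp: R.level_class_def split: if_splits)
        moreover have "lev b = lev (f d) + 1 \<or> lev b = lev (f d) - 1" using R.edge_lev[OF e'] by auto
        ultimately show False using iX by (auto simp: X_def)
      qed
    qed
    then show ?thesis using min[OF S'(1)] S'(2) card_leaf_set' by auto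
  qed
  have "(\<Sum>i<?M. (?l - 1) + (if i \<in> X then 0 else 1)) \<le> (\<Sum>i<?M. card (R.level_class 1 d i))"
    using low by (intro sum_mono) auto
  also have "\<dots> \<le> card V' + card (leaf_set V' E')"
    using R.sum_card_level_class[of d 1] d deep by auto
  also have "(\<Sum>i<?M. (?l - 1) + (if i \<in> X then 0 else 1)) = ?M * (?l - 1) + card ({..<?M} - X)"
    by (simp only: sum.distrib sum.If_cases[OF finite_lessThan] Diff_eq) simp
  finally have "?M * (?l - 1) + card ({..<?M} - X) \<le> card V' + card (leaf_set V' E')" .
  moreover have "?M - 2 \<le> card ({..<?M} - X)"
    using diff_card_le_card_Diff[of X "{..<?M}"] cX by (auto simp: X_def)
  moreover have "(d + 1) * ?l = (d + 1) * (?l - 1) + (d + 1)"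
    using card_leaf_set' by (metis add_diff_cancel_right' distrib_left mult.right_neutral)
  moreover have "?M * (?l - 1) = (d + 1) * (?l - 1) + (?l - 1)" by simp
  ultimately show False using cardV card_V' card_leaf_set' d k by linarith
qed

end

section \<open>The bound and the extremal trees\<close>

lemma (in diam_tree) level_class_average:
  assumes "2 \<le> d" "t \<le> d" "d \<le> lev x" and min: "\<And>S. indep_dom d V E S \<Longrightarrow> g \<le> card S"
  shows "(d + 1 + t) * g \<le> card V + t * card (leaf_set V E)"
proof -
  have "(d + 1 + t) * g = (\<Sum>i<d + 1 + t. g)" by simp
  also have "\<dots> \<le> (\<Sum>i<d + 1 + t. card (level_class t d i))"
    using min level_class_indep_dom assms by (intro sum_mono) auto
  also have "\<dots> \<le> card V + t * card (leaf_set V E)"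
    using sum_card_level_class assms by auto
  finally show ?thesis .
qed

lemma (in diam_tree) lev_x_pos:
  assumes "2 \<le> card V"
  shows "lev x \<noteq> 0"
proof
  assume "lev x = 0"
  then have "V \<subseteq> {r}" using lev_le lev_eq_0 by fastforce
  then have "card V \<le> 1" using card_mono[of "{r}" V] by auto
  then show False using assms by auto
qed

text \<open>Write \<open>n\<close> and \<open>l\<close> for the numbers of vertices and leaves. For
  depth at least \<open>d\<close>, the bounds \<open>(d + 1) * g \<le> n\<close> and
  \<open>(d + 3) * g \<le> n + 2 * l\<close> add up to twice the claim, so equality makes both tight
  and \<open>g = l\<close>. For smaller depth \<open>g \<le> 1\<close>, and equality means
  \<open>n + l = d + 2\<close> with \<open>d \<le> n\<close> and \<open>2 \<le> l\<close>.\<close>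

lemma utree_indep_dom_bound:
  assumes T: "utree V E" and d: "2 \<le> d" "d \<le> card V"
    and min: "\<And>S. indep_dom d V E S \<Longrightarrow> g \<le> card S"
  shows "(d + 2) * g \<le> card V + card (leaf_set V E)"
    and "(d + 2) * g = card V + card (leaf_set V E) \<Longrightarrow>
      card V = d \<and> card (leaf_set V E) = 2 \<or>
      g = card (leaf_set V E) \<and> card V = (d + 1) * card (leaf_set V E) \<and> 2 \<le> card (leaf_set V E)"
proof -
  let ?n = "card V" and ?l = "card (leaf_set V E)"
  have "V \<noteq> {}" using d by auto
  then obtain r lev par x where R: "diam_tree V E r lev par x"
    using utree_diam_tree[OF T] by blast
  interpret R: diam_tree V E r lev par x by fact
  have l2: "2 \<le> ?l" using R.two_leaves R.lev_x_pos d by auto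
  have "(d + 2) * g \<le> ?n + ?l \<and> ((d + 2) * g = ?n + ?l \<longrightarrow>
    ?n = d \<and> ?l = 2 \<or> g = ?l \<and> ?n = (d + 1) * ?l)"
  proof (cases "d \<le> lev x")
    case True
    have "(d + 1 + 0) * g \<le> ?n + 0 * ?l" "(d + 1 + 2) * g \<le> ?n + 2 * ?l"
      using R.level_class_average[OF d(1) _ True min] d by blast+
    then have *: "(d + 1) * g \<le> ?n" "(d + 1) * g + 2 * g \<le> ?n + 2 * ?l"
      by (simp_all add: algebra_simps)
    moreover have "(d + 2) * g = (d + 1) * g + g" by simp
    ultimately have "(d + 2) * g \<le> ?n + ?l"
      and "(d + 2) * g = ?n + ?l \<Longrightarrow> g = ?l \<and> ?n = (d + 1) * g" by linarith+
    then show ?thesis by metis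
  next
    case False
    then have "indep_dom d V E {x}" using R.centre_indep_dom by auto
    then have "g \<le> card {x}" by (rule min)
    then have "g = 0 \<or> g = 1" by auto
    then show ?thesis using l2 d by auto
  qed
  then show "(d + 2) * g \<le> ?n + ?l"
    "(d + 2) * g = ?n + ?l \<Longrightarrow> ?n = d \<and> ?l = 2 \<or> g = ?l \<and> ?n = (d + 1) * ?l \<and> 2 \<le> ?l"
    using l2 by blast+
qed

text \<open>The leaves are \<open>r\<close> and \<open>x\<close>, so every vertex other than
  \<open>x\<close> has a child. By induction from the deepest level upwards, two vertices of one
  level have a common child and hence coincide; so the level numbers the vertices of a path.\<close>

lemma utree_two_leaves_path:
  assumes T: "utree V E" and V: "2 \<le> card V" and two: "card (leaf_set V E) = 2"
  shows "\<exists>h. bij_betw h V {0..<card V} \<and>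
    (\<forall>u\<in>V. \<forall>v\<in>V. (u, v) \<in> E \<longleftrightarrow> h v = h u + 1 \<or> h u = h v + (1 :: nat))"
proof -
  have "V \<noteq> {}" using V by auto
  then obtain r lev par x where R: "diam_tree V E r lev par x"
    using utree_diam_tree[OF T] by blast
  interpret R: diam_tree V E r lev par x by fact
  have x0: "lev x \<noteq> 0" using R.lev_x_pos V by auto
  have "{r, x} \<subseteq> leaf_set V E" using R.root_leaf R.x_leaf x0 by auto
  moreover have "finite (leaf_set V E)" using R.finV by (auto simp: leaf_set_def)
  ultimately have L: "leaf_set V E = {r, x}"
    using card_subset_eq[of "leaf_set V E" "{r, x}"] two R.x_leaf x0 by auto
  have same: "u = v" if "u \<in> V" "v \<in> V" "lev u = lev v" for u v
    using that
  proof (induction "lev x - lev u" arbitrary: u v)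
    case 0
    have "w = x" if w: "w \<in> V" "lev w = lev x" for w
    proof -
      have "w \<noteq> r" using w x0 R.lev_root by auto
      moreover have "lev c < lev w" if "(w, c) \<in> E" for c
        using R.edge_lev[OF that] R.lev_le[of c] R.arcs_in that w by auto
      ultimately have "w \<in> leaf_set V E" using R.leaf_iff w by auto
      then show ?thesis using L \<open>w \<noteq> r\<close> by auto
    qed
    then show ?case using 0 R.lev_le[of u] by (metis diff_is_0_eq le_antisym)
  next
    case (Suc k)
    have ch: "\<exists>c\<in>V. (w, c) \<in> E \<and> lev c = Suc (lev w)" if "w \<in> V" "lev w = lev u" for w
    proof -
      have "w \<noteq> x" using that Suc.hyps(2) by auto
      then show ?thesis using R.has_child[OF that(1) x0] L by auto
    qed
    obtain c where c: "c \<in> V" "(u, c) \<in> E" "lev c = Suc (lev u)" using ch Suc.prems by blast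
    obtain c' where c': "c' \<in> V" "(v, c') \<in> E" "lev c' = Suc (lev v)"
      using ch[of v] Suc.prems by auto
    have "c = c'" using Suc.hyps c c' Suc.prems by (intro Suc.hyps(1)) auto
    then show ?case using R.edge_lev[OF c(2)] R.edge_lev[OF c'(2)] c c' by auto
  qed
  have inj: "inj_on lev V" using same by (auto simp: inj_on_def)
  have img: "lev ` V = {0..<Suc (lev x)}"
  proof
    show "lev ` V \<subseteq> {0..<Suc (lev x)}" using R.lev_le by (auto simp: less_Suc_eq_le)
    have "i \<in> lev ` V" if "i \<le> lev x" for i
      using R.anc_facts[OF R.x_in that] by (metis image_eqI)
    then show "{0..<Suc (lev x)} \<subseteq> lev ` V" by auto
  qed
  have "card V = Suc (lev x)" using card_image[OF inj] img by simp
  moreover have "(u, v) \<in> E" if uv: "u \<in> V" "v \<in> V" "lev v = lev u + 1" for u v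
  proof -
    have "v \<noteq> r" using uv R.lev_root by auto
    then have p: "(v, par v) \<in> E" "lev (par v) = lev u" using R.par_edge R.lev_par uv by auto
    then have "par v = u" using same uv R.arcs_in by auto
    then show ?thesis using p R.symE by auto
  qed
  then have "(u, v) \<in> E \<longleftrightarrow> lev v = lev u + 1 \<or> lev u = lev v + 1" if "u \<in> V" "v \<in> V" for u v
    using R.edge_lev[of u v] R.symE that by auto
  ultimately show ?thesis using inj img by (intro exI[of _ lev]) (auto simp: bij_betw_def)
qed

text \<open>At a common vertex with \<open>i + j\<close> minimal, comparing degrees gives
  \<open>0 < i\<close> and \<open>0 < j\<close>, and by minimality the paths run in opposite
  directions there. Their parts up to this vertex are then closed under neighbours, but have at most
  \<open>2 * d\<close> vertices.\<close>

lemma pendant_interiors_disjoint: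
  assumes T: "utree V E" and f: "pendant V E f d" and g: "pendant V E g d" and ne: "f 0 \<noteq> g 0"
    and V: "2 * d < card V"
  shows "f ` {..<d} \<inter> g ` {..<d} = {}"
proof (rule ccontr)
  assume "\<not> ?thesis"
  then have ex: "\<exists>n i j. n = i + j \<and> i < d \<and> j < d \<and> f i = g j" by auto
  define n where "n = (LEAST n. \<exists>i j. n = i + j \<and> i < d \<and> j < d \<and> f i = g j)"
  obtain i j where ij: "n = i + j" "i < d" "j < d" "f i = g j"
    using LeastI_ex[OF ex] unfolding n_def by blast
  have min: "f i' \<noteq> g j'" if "i' < d" "j' < d" "i' + j' < n" for i' j'
    using not_less_Least[of "i' + j'" "\<lambda>n. \<exists>i j. n = i + j \<and> i < d \<and> j < d \<and> f i = g j"] that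
    unfolding n_def by blast
  have deg: "card (E `` {h i}) = (if i = 0 then 1 else 2)" if "pendant V E h d" "i < d" for h i
    using pendant_nbrs[OF that] pendant_inj[OF that(1), of "i - 1" "i + 1"] that by auto
  have "(if i = 0 then 1 else 2) = (if j = 0 then 1 else (2 :: nat))"
    using deg[OF f ij(2)] deg[OF g ij(3)] ij(4) by metis
  then have "i = 0 \<longleftrightarrow> j = 0" by presburger
  then have pos: "0 < i" "0 < j" using ij ne by auto
  have "{f (i - 1), f (i + 1)} = {g (j - 1), g (j + 1)}"
    using pendant_nbrs[OF f ij(2)] pendant_nbrs[OF g ij(3)] ij(4) pos by auto
  moreover have "f (i - 1) \<noteq> g (j - 1)" using min ij pos by auto
  ultimately have cross: "f (i + 1) = g (j - 1)" "f (i - 1) = g (j + 1)" by (auto simp: doubleton_eq_iff)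
  let ?U = "f ` {..i} \<union> g ` {..j}"
  have out: "f (i + 1) \<in> ?U" "g (j + 1) \<in> ?U"
    using cross by (metis UnI2 atMost_iff diff_le_self imageI, metis UnI1 atMost_iff diff_le_self imageI)
  have "y \<in> ?U" if "m \<le> i" "(f m, y) \<in> E" for m y
  proof -
    have "y = f (Suc m) \<or> 0 < m \<and> y = f (m - 1)"
      using pendant_edge_cases[OF f _ that(2)] that ij by auto
    then show ?thesis using that out by (cases "m = i") auto
  qed
  moreover have "y \<in> ?U" if "m \<le> j" "(g m, y) \<in> E" for m y
  proof -
    have "y = g (Suc m) \<or> 0 < m \<and> y = g (m - 1)"
      using pendant_edge_cases[OF g _ that(2)] that ij by auto
    then show ?thesis using that out by (cases "m = j") auto
  qed
  ultimately have "E `` ?U \<subseteq> ?U" by blast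
  moreover have "?U \<subseteq> V" using f g ij by (auto simp: pendant_def)
  ultimately have "?U = V" using utree_closed_set[OF T] by auto
  moreover have "card ?U \<le> Suc i + Suc j"
    using card_Un_le[of "f ` {..i}" "g ` {..j}"] card_image_le[of "{..i}" f] card_image_le[of "{..j}" g]
    by auto
  ultimately show False using V ij by auto
qed

text \<open>Such a meeting forces \<open>i = d - 1\<close>, and both paths end with the same edge,
  in opposite directions. Their vertices of index below \<open>d\<close> are then closed under
  neighbours, but there are at most \<open>2 * d\<close> of them.\<close>

lemma pendant_not_crossing:
  assumes T: "utree V E" and f: "pendant V E f d" and g: "pendant V E g d" and ne: "f 0 \<noteq> g 0"
    and V: "2 * d < card V" and i: "i < d"
  shows "f i \<noteq> g d"
proof
  assume eq: "f i = g d"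
  have disj: "f a \<noteq> g b" if "a < d" "b < d" for a b
    using pendant_interiors_disjoint[OF T f g ne V] that by auto
  have "(f i, g (d - 1)) \<in> E" using pendant_end_nbr[OF T g] i eq by auto
  then have "g (d - 1) = f (Suc i) \<or> 0 < i \<and> g (d - 1) = f (i - 1)"
    using pendant_edge_cases[OF f i] by auto
  moreover have "f (i - 1) \<noteq> g (d - 1)" using i by (intro disj) auto
  ultimately have nxt: "g (d - 1) = f (Suc i)" by metis
  moreover have "\<not> Suc i < d" using disj[of "Suc i" "d - 1"] nxt by auto
  ultimately have id: "Suc i = d" using i by linarith
  have cross: "f d = g (d - 1)" "f (d - 1) = g d" using nxt eq id by (metis diff_Suc_1)+
  let ?U = "f ` {..<d} \<union> g ` {..<d}"
  have step: "y \<in> h ` {..<d} \<or> y = h d" if "pendant V E h d" "m < d" "(h m, y) \<in> E" for h m y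
    using pendant_edge_cases[OF that] that(2) by (cases "Suc m = d") auto
  have "d - 1 \<in> {..<d}" using i by auto
  then have "f d \<in> ?U" "g d \<in> ?U" using cross by (metis UnI2 imageI, metis UnI1 imageI)
  then have "E `` ?U \<subseteq> ?U" using step[OF f] step[OF g] by blast
  moreover have "?U \<subseteq> V" using f g by (auto simp: pendant_def)
  moreover have "?U \<noteq> {}" using i by auto
  ultimately have "?U = V" using utree_closed_set[OF T] by auto
  moreover have "card ?U \<le> d + d"
    using card_Un_le[of "f ` {..<d}" "g ` {..<d}"] card_image_le[of "{..<d}" f] card_image_le[of "{..<d}" g]
    by auto
  ultimately show False using V by auto
qed

text \<open>Two leaves guarantee more than \<open>2 * d + 1\<close> vertices, as disjointness
  requires. A common end of two paths is excluded by \<open>pendant_no_twin\<close> if its degree is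
  at least 3; with degree 2 the two paths would be the whole tree. Disjoint paths of
  \<open>d + 1\<close> vertices at all leaves exhaust \<open>V\<close>.\<close>

lemma extremal_pendants:
  assumes T: "utree V E" and d: "2 \<le> d" and l2: "2 \<le> card (leaf_set V E)"
    and V: "card V = (d + 1) * card (leaf_set V E)"
    and min: "\<And>S. indep_dom d V E S \<Longrightarrow> card (leaf_set V E) \<le> card S"
  shows "\<exists>F. (\<forall>z\<in>leaf_set V E. pendant V E (F z) d) \<and>
    (\<forall>z\<in>leaf_set V E. \<forall>z'\<in>leaf_set V E. \<forall>i\<le>d. \<forall>j\<le>d. F z i = F z' j \<longleftrightarrow> z = z' \<and> i = j) \<and>
    V = (\<Union>z\<in>leaf_set V E. F z ` {..d})"
proof -
  let ?L = "leaf_set V E"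
  have "(d + 1) * 2 \<le> (d + 1) * card ?L" using l2 by (intro mult_le_mono) auto
  then have big: "2 * d + 1 < card V" using V by simp
  have finV: "finite V" using T by (simp add: utree_def)
  have finL: "finite ?L" using finV by (simp add: leaf_set_def)
  have "\<exists>f. f 0 = z \<and> pendant V E f d" if z: "z \<in> ?L" for z
  proof -
    obtain f j where f: "f 0 = z" "1 \<le> j" "j \<le> d" "pendant V E f j" "j < d \<longrightarrow> 3 \<le> card (E `` {f j})"
      using pendant_from_leaf[OF T z, of d] d big by auto
    have "\<not> j < d"
    proof
      assume jd: "j < d"
      then interpret P: pendant_path V E f j using T f by unfold_locales auto
      show False using P.pendant_not_short[OF d jd _ min] V by simp
    qed
    then show ?thesis using f by auto
  qed
  then obtain F where F0: "\<And>z. z \<in> ?L \<Longrightarrow> F z 0 = z" and F: "\<And>z. z \<in> ?L \<Longrightarrow> pendant V E (F z) d"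
    by metis
  have leaf_nbrs: "card (E `` {y}) = 2" if z: "z \<in> ?L" "(z, y) \<in> E" for z y
  proof -
    have "y = F z 1" using pendant_edge_cases[OF F[OF z(1)], of 0 y] F0 z d by auto
    then show ?thesis
      using pendant_nbrs[OF F[OF z(1)], of 1] pendant_inj[OF F[OF z(1)], of 0 "1 + 1"] d by auto
  qed
  have interior: "F z i \<noteq> F z' j" if "z \<in> ?L" "z' \<in> ?L" "z \<noteq> z'" "i < d" "j < d" for z z' i j
    using pendant_interiors_disjoint[OF T F[OF that(1)] F[OF that(2)]] F0 that big by auto
  have crossing: "F z i \<noteq> F z' d" if "z \<in> ?L" "z' \<in> ?L" "z \<noteq> z'" "i < d" for z z' i
    using pendant_not_crossing[OF T F[OF that(1)] F[OF that(2)]] F0 that big by auto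
  have ends: "F z d \<noteq> F z' d" if z: "z \<in> ?L" "z' \<in> ?L" "z \<noteq> z'" for z z'
  proof
    assume eq: "F z d = F z' d"
    let ?f = "F z" and ?g = "F z'"
    have fin: "finite (E `` {?f d})" by (rule utree_finite_nbrs[OF T])
    have "?f (d - 1) \<in> E `` {?f d}" "?g (d - 1) \<in> E `` {?f d}"
      using pendant_end_nbr[OF T F[OF z(1)]] pendant_end_nbr[OF T F[OF z(2)]] d by (simp, simp add: eq)
    then have two: "{?f (d - 1), ?g (d - 1)} \<subseteq> E `` {?f d}" "card {?f (d - 1), ?g (d - 1)} = 2"
      using interior[OF z, of "d - 1" "d - 1"] d by auto
    show False
    proof (cases "card (E `` {?f d}) = 2")
      case True
      then have nb: "E `` {?f d} = {?f (d - 1), ?g (d - 1)}"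
        using card_subset_eq[OF fin two(1)] two(2) by simp
      let ?U = "?f ` {..d} \<union> ?g ` {..<d}"
      have "?g d \<in> ?U" unfolding eq[symmetric] by simp
      have step: "y \<in> F w ` {..<d} \<or> y = F w d" if "w \<in> ?L" "m < d" "(F w m, y) \<in> E" for w m y
        using pendant_edge_cases[OF F[OF that(1)] that(2,3)] that(2) by (cases "Suc m = d") auto
      have "y \<in> ?U" if m: "m \<le> d" "(?f m, y) \<in> E" for m y
      proof (cases "m = d")
        case True
        then have "y \<in> {?f (d - 1), ?g (d - 1)}" using m nb by blast
        then show ?thesis using d by auto
      next
        case False
        then show ?thesis using step[OF z(1) _ m(2)] m by fastforce
      qed
      moreover have "y \<in> ?U" if m: "m < d" "(?g m, y) \<in> E" for m y
        using step[OF z(2) m] \<open>?g d \<in> ?U\<close> by auto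
      ultimately have "E `` ?U \<subseteq> ?U" by blast
      moreover have "?U \<subseteq> V" using F[OF z(1)] F[OF z(2)] by (auto simp: pendant_def)
      ultimately have "?U = V" using utree_closed_set[OF T] by auto
      moreover have "card ?U \<le> Suc d + d"
        using card_Un_le[of "?f ` {..d}" "?g ` {..<d}"] card_image_le[of "{..d}" ?f]
          card_image_le[of "{..<d}" ?g] by auto
      ultimately show False using big by auto
    next
      case False
      moreover have "2 \<le> card (E `` {?f d})" using card_mono[OF fin two(1)] two(2) by simp
      ultimately interpret P: pendant_path V E ?f d
        using T F[OF z(1)] d by unfold_locales auto
      have "?g ` {..<d} \<inter> ?f ` {..<d} = {}" using interior[OF z] by fastforce
      then show False
        using P.pendant_no_twin[OF d refl F[OF z(2)] eq[symmetric] _ leaf_nbrs _ min] V by auto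
    qed
  qed
  have uniq: "F z i = F z' j \<longleftrightarrow> z = z' \<and> i = j"
    if z: "z \<in> ?L" "z' \<in> ?L" "i \<le> d" "j \<le> d" for z z' i j
  proof (cases "z = z'")
    case True
    then show ?thesis using pendant_inj[OF F] z by auto
  next
    case False
    then show ?thesis using interior[of z z' i j] crossing[of z z' i] crossing[of z' z j] ends[of z z'] z
      by (cases "i = d"; cases "j = d") (auto simp: eq_commute)
  qed
  let ?U = "\<Union>z\<in>?L. F z ` {..d}"
  have "card ?U = (\<Sum>z\<in>?L. card (F z ` {..d}))"
    using finL uniq by (intro card_UN_disjoint) auto
  also have "\<dots> = (\<Sum>z\<in>?L. d + 1)"
    using F by (intro sum.cong refl) (auto simp: pendant_def card_image)
  finally have "card ?U = card V" using V by simp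
  moreover have "?U \<subseteq> V" using F unfolding pendant_def by blast
  ultimately have "V = ?U" using card_subset_eq[OF finV, of ?U] by simp
  then show ?thesis using F uniq by blast
qed

section \<open>Graphs and their isomorphisms\<close>

lemma graph_tree_wf: "graph_tree T \<Longrightarrow> pair_wf_digraph T"
  by (simp add: graph_tree_def pair_graph_def pair_digraph_def pair_fin_digraph_def)

text \<open>A walk joining the ends of an edge without using it yields a path of length at least 2,
  which the edge closes to a cycle of length at least 3.\<close>

lemma graph_tree_utree:
  assumes "graph_tree T"
  shows "utree (pverts T) (parcs T)"
proof -
  interpret pair_graph T using assms by (simp add: graph_tree_def)
  have arcs: "parcs T \<subseteq> pverts T \<times> pverts T" using wellformed' by auto
  have sy: "(v, u) \<in> parcs T" if "(u, v) \<in> parcs T" for u v using that arcs_symmetric by auto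
  have "(u, v) \<in> (parcs T)\<^sup>*" if "u \<in> pverts T" "v \<in> pverts T" for u v
  proof -
    have "reachable (with_proj (mk_symmetric (with_proj T))) u v"
      using assms that by (auto simp: graph_tree_def connected_def strongly_connected_def)
    then have "reachable (with_proj T) u v" using reachable_mk_symmetric_eq[OF sym_arcs] by simp
    then show ?thesis using reachable_rtranclI[of "with_proj T" u v] by simp
  qed
  moreover have "(u, v) \<notin> (parcs T - {(u, v), (v, u)})\<^sup>*" if uv: "(u, v) \<in> parcs T" for u v
  proof
    let ?H = "\<lparr>pverts = pverts T, parcs = parcs T - {(u, v), (v, u)}\<rparr>"
    assume "(u, v) \<in> (parcs T - {(u, v), (v, u)})\<^sup>*"
    interpret H: pair_wf_digraph ?H using arcs by unfold_locales auto
    have "reachable (with_proj ?H) u v"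
      unfolding reachable_def
      by (rule rtrancl_consistent_rtrancl_on)
        (use \<open>(u, v) \<in> (parcs T - {(u, v), (v, u)})\<^sup>*\<close> uv arcs in auto)
    then obtain p where p: "H.apath u p v" using H.reachable_apath by blast
    have "subgraph (with_proj ?H) (with_proj T)"
      by (rule subgraphI) (auto simp: compatible_def, unfold_locales)
    then have pT: "apath u p v" using subgraph_apath_imp_apath p by blast
    have set_p: "set p \<subseteq> parcs T - {(u, v), (v, u)}" using p by (auto simp: H.apath_def H.awalk_def)
    have "u \<noteq> v" using uv no_loops' by auto
    have "2 \<le> length p"
    proof (rule ccontr)
      assume "\<not> 2 \<le> length p"
      then consider "p = []" | e where "p = [e]"
        by (metis One_nat_def Suc_1 Suc_leI le_SucE length_0_conv length_Suc_conv not_less_eq_eq not_less_zero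
            le_zero_eq)
      then show False
      proof cases
        case 1
        then show False using pT \<open>u \<noteq> v\<close> by (auto simp: apath_def awalk_def)
      next
        case 2
        then have "e = (u, v)" using pT by (auto simp: apath_def awalk_def prod_eq_iff)
        then show False using set_p 2 by auto
      qed
    qed
    moreover have "cycle ((v, u) # p)"
      unfolding cycle_def using pT sy[OF uv] arcs by (auto simp: apath_def awalk_def intro!: exI[of _ v])
    ultimately show False using assms unfolding graph_tree_def by fastforce
  qed
  moreover have "sym (parcs T)" using sy by (auto simp: sym_def)
  ultimately show ?thesis using arcs pair_finite_verts by (simp add: utree_def)
qed

lemma leaves_eq_leaf_set: "leaves T = leaf_set (pverts T) (parcs T)"
proof -
  have "out_degree (with_proj T) v = card (parcs T `` {v})" for v
  proof -
    have "out_arcs (with_proj T) v = Pair v ` (parcs T `` {v})" by (auto simp: out_arcs_def)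
    then show ?thesis by (simp add: out_degree_def card_image inj_on_def)
  qed
  then show ?thesis by (simp add: leaves_def leaf_set_def)
qed

lemma graph_dist_le:
  assumes "pair_wf_digraph T" "v \<in> pverts T" "(v, u) \<in> parcs T ^^ k"
  shows "graph_dist T v u \<le> ereal (real k)"
proof -
  interpret pair_wf_digraph T by fact
  have "\<exists>p. awalk v p u \<and> length p = k"
    using assms(2,3)
  proof (induction k arbitrary: v)
    case 0
    then show ?case by (auto simp: awalk_Nil_iff)
  next
    case (Suc k)
    then obtain w where w: "(v, w) \<in> parcs T" "(w, u) \<in> parcs T ^^ k" by (meson relpow_Suc_E2)
    then obtain p where "awalk w p u" "length p = k" using Suc.IH wellformed' by blast
    then show ?case using w Suc.prems by (intro exI[of _ "(v, w) # p"]) (auto simp: awalk_Cons_iff)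
  qed
  then obtain p where p: "awalk v p u" "length p = k" by auto
  have "awalk_cost (\<lambda>_. 1) p = real k" using p(2) by (induction p arbitrary: k) auto
  then show ?thesis using min_cost_le_walk_cost[OF p(1), of "\<lambda>_. 1"] by (simp add: graph_dist_def)
qed

text \<open>\<open>\<phi>\<close> is a potential: each arc raises it by at most 1, so a walk raises
  it by at most its length.\<close>

lemma graph_dist_ge:
  assumes "pair_wf_digraph T" "\<And>a b. (a, b) \<in> parcs T \<Longrightarrow> \<phi> b \<le> \<phi> a + (1 :: nat)"
  shows "ereal (real (\<phi> u)) \<le> ereal (real (\<phi> v)) + graph_dist T v u"
proof -
  interpret pair_wf_digraph T by fact
  have "\<phi> u \<le> \<phi> v + length p" if "awalk v p u" for p
    using that
  proof (induction p arbitrary: v)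
    case Nil
    then show ?case by (auto simp: awalk_Nil_iff)
  next
    case (Cons e p)
    then have "e \<in> parcs T" "fst e = v" "awalk (snd e) p u" by (auto simp: awalk_Cons_iff)
    then show ?case using Cons.IH[of "snd e"] assms(2)[of v "snd e"] by force
  qed
  moreover have "awalk_cost (\<lambda>_. 1) p = real (length p)" for p :: "('a \<times> 'a) list"
    by (induction p) auto
  ultimately have "ereal (real (\<phi> u) - real (\<phi> v)) \<le> graph_dist T v u"
    unfolding graph_dist_def \<mu>_def by (intro INF_greatest) force
  then show ?thesis by (cases "graph_dist T v u") auto
qed

lemma indep_dom_imp:
  assumes "pair_wf_digraph T" "indep_dom d (pverts T) (parcs T) S"
  shows "independent_set T S" "distance_dominating d T S"
proof -
  show "independent_set T S" using assms(2) by (auto simp: indep_dom_def independent_set_def)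
  have "\<exists>u\<in>S. graph_dist T v u \<le> ereal (real d)" if v: "v \<in> pverts T" for v
  proof -
    obtain u k where u: "u \<in> S" "k \<le> d" "(v, u) \<in> parcs T ^^ k"
      using assms(2) v unfolding indep_dom_def by blast
    then have "graph_dist T v u \<le> ereal (real k)" using graph_dist_le[OF assms(1) v] by blast
    also have "\<dots> \<le> ereal (real d)" using u by simp
    finally show ?thesis using u by blast
  qed
  then show "distance_dominating d T S" by (simp add: distance_dominating_def)
qed

lemma indep_dist_dom_number_le:
  assumes "pair_wf_digraph T" "indep_dom d (pverts T) (parcs T) S"
  shows "indep_dist_dom_number d T \<le> card S"
  unfolding indep_dist_dom_number_def using indep_dom_imp[OF assms] by (intro Least_le) auto

lemma utree_ex_indep_dom:
  assumes "utree V E" "V \<noteq> {}" "2 \<le> d"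
  obtains S where "indep_dom d V E S"
proof -
  obtain r lev par x where R: "diam_tree V E r lev par x" using utree_diam_tree[OF assms(1,2)] .
  interpret R: diam_tree V E r lev par x by fact
  show ?thesis
    using that R.level_class_indep_dom[of d 0 0] R.centre_indep_dom[of d] assms(3)
    by (cases "d \<le> lev x") auto
qed

text \<open>Independence is dropped, since the lower bounds for the extremal trees rest on
  domination alone.\<close>

lemma indep_dist_dom_number_attained:
  assumes "graph_tree T" "pverts T \<noteq> {}" "2 \<le> d"
  obtains S where "S \<subseteq> pverts T" "distance_dominating d T S" "card S = indep_dist_dom_number d T"
proof -
  have wf: "pair_wf_digraph T" by (rule graph_tree_wf[OF assms(1)])
  obtain S0 where S0: "indep_dom d (pverts T) (parcs T) S0"
    using utree_ex_indep_dom[OF graph_tree_utree[OF assms(1)] assms(2,3)] .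
  have "\<exists>k S. independent_set T S \<and> distance_dominating d T S \<and> card S = k"
    using indep_dom_imp[OF wf S0] by blast
  then have "\<exists>S. independent_set T S \<and> distance_dominating d T S \<and> card S = indep_dist_dom_number d T"
    unfolding indep_dist_dom_number_def by (rule LeastI_ex)
  then show ?thesis using that by (auto simp: independent_set_def)
qed

text \<open>A \<open>digraph_iso\<close> maps vertices and arcs separately. Between graphs whose
  arcs are pairs, incidence determines the arc map from the vertex map.\<close>

lemma graph_iso_iff:
  assumes G: "pair_wf_digraph G" and H: "pair_wf_digraph H"
  shows "graph_iso G H \<longleftrightarrow> (\<exists>h. bij_betw h (pverts G) (pverts H) \<and>
    (\<forall>u\<in>pverts G. \<forall>v\<in>pverts G. (u, v) \<in> parcs G \<longleftrightarrow> (h u, h v) \<in> parcs H))" (is "_ \<longleftrightarrow> ?R")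
proof
  interpret G: pair_wf_digraph G by fact
  interpret H: pair_wf_digraph H by fact
  {
    assume "graph_iso G H"
    then obtain f where f: "G.digraph_isomorphism f" and eq: "with_proj H = app_iso f (with_proj G)"
      unfolding graph_iso_def digraph_iso_def by blast
    let ?h = "iso_verts f"
    have V: "pverts H = ?h ` pverts G" using arg_cong[OF eq, of verts] by simp
    have A: "parcs H = iso_arcs f ` parcs G" using arg_cong[OF eq, of arcs] by simp
    have ht: "iso_tail f = fst" "iso_head f = snd"
      using arg_cong[OF eq, of tail] arg_cong[OF eq, of head] by simp_all
    have inj: "inj_on ?h (pverts G)" using f by (simp add: G.digraph_isomorphism_def)
    have "iso_arcs f a = (?h (fst a), ?h (snd a))" if "a \<in> parcs G" for a
      using f that ht by (simp add: G.digraph_isomorphism_def)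
    then have A: "parcs H = (\<lambda>a. (?h (fst a), ?h (snd a))) ` parcs G" using A by simp
    have "(u, v) \<in> parcs G \<longleftrightarrow> (?h u, ?h v) \<in> parcs H" if "u \<in> pverts G" "v \<in> pverts G" for u v
    proof -
      have "(?h u, ?h v) \<in> parcs H \<longleftrightarrow> (\<exists>a b. (a, b) \<in> parcs G \<and> ?h u = ?h a \<and> ?h v = ?h b)"
        unfolding A by force
      also have "\<dots> \<longleftrightarrow> (u, v) \<in> parcs G"
        using that G.wellformed' inj by (metis inj_onD)
      finally show ?thesis by simp
    qed
    then show ?R using V inj by (intro exI[of _ ?h]) (auto simp: bij_betw_def)
  next
    assume ?R
    then obtain h where h: "bij_betw h (pverts G) (pverts H)"
      "\<And>u v. u \<in> pverts G \<Longrightarrow> v \<in> pverts G \<Longrightarrow> (u, v) \<in> parcs G \<longleftrightarrow> (h u, h v) \<in> parcs H" by blast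
    let ?f = "\<lparr>iso_verts = h, iso_arcs = map_prod h h, iso_head = snd, iso_tail = fst\<rparr>"
    have inj: "inj_on h (pverts G)" using h by (simp add: bij_betw_def)
    have "parcs G \<subseteq> pverts G \<times> pverts G" using G.wellformed' by auto
    moreover have "inj_on (map_prod h h) (pverts G \<times> pverts G)" using inj by (simp add: map_prod_inj_on)
    ultimately have inj2: "inj_on (map_prod h h) (parcs G)" by (rule inj_on_subset[rotated])
    have "G.digraph_isomorphism ?f"
      unfolding G.digraph_isomorphism_def using inj inj2 G.wf_digraph_axioms by auto
    moreover have "parcs H = map_prod h h ` parcs G"
    proof
      show "parcs H \<subseteq> map_prod h h ` parcs G"
      proof
        fix a assume a: "a \<in> parcs H"
        then have "fst a \<in> h ` pverts G" "snd a \<in> h ` pverts G"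
          using H.wellformed' h(1) by (cases a; auto simp: bij_betw_def)+
        then obtain u v where uv: "u \<in> pverts G" "v \<in> pverts G" "a = (h u, h v)" by (cases a) auto
        then have "(u, v) \<in> parcs G" using a h(2) by blast
        then show "a \<in> map_prod h h ` parcs G" using uv by (intro image_eqI[of _ _ "(u, v)"]) auto
      qed
      have "(h u, h v) \<in> parcs H" if "(u, v) \<in> parcs G" for u v
        using h(2) G.wellformed'(1)[OF that] G.wellformed'(2)[OF that] that by blast
      then show "map_prod h h ` parcs G \<subseteq> parcs H" by auto
    qed
    then have "with_proj H = app_iso ?f (with_proj G)"
      using h(1) by (simp add: app_iso_def with_proj_def bij_betw_def)
    ultimately show "graph_iso G H" unfolding graph_iso_def digraph_iso_def by blast
  }
qed

lemma card_leaf_set_iso: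
  assumes h: "bij_betw h V W" "\<And>u v. u \<in> V \<Longrightarrow> v \<in> V \<Longrightarrow> (u, v) \<in> E \<longleftrightarrow> (h u, h v) \<in> F"
    and E: "E \<subseteq> V \<times> V" and F: "F \<subseteq> W \<times> W"
  shows "card (leaf_set V E) = card (leaf_set W F)"
proof -
  have inj: "inj_on h V" and img: "h ` V = W" using h(1) by (auto simp: bij_betw_def)
  have "card (E `` {v}) = card (F `` {h v})" if v: "v \<in> V" for v
  proof -
    have "y \<in> h ` (E `` {v})" if "(h v, y) \<in> F" for y
    proof -
      have "y \<in> h ` V" using F that img by auto
      then show ?thesis using h(2) v that by auto
    qed
    moreover have "(h v, h y) \<in> F" if "(v, y) \<in> E" for y using h(2) v E that by auto
    ultimately have "F `` {h v} = h ` (E `` {v})" by auto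
    moreover have "inj_on h (E `` {v})" using inj E by (auto intro: inj_on_subset)
    ultimately show ?thesis by (simp add: card_image)
  qed
  then have "leaf_set W F = h ` leaf_set V E" using img by (auto simp: leaf_set_def)
  moreover have "inj_on h (leaf_set V E)" using inj by (rule inj_on_subset) (auto simp: leaf_set_def)
  ultimately show ?thesis by (simp add: card_image)
qed

section \<open>Paths and graphs with attached paths\<close>

lemma path_graph_wf: "pair_wf_digraph (path_graph d)"
  by unfold_locales (auto simp: path_graph_def)

lemma path_graph_leaf_set:
  assumes "2 \<le> d"
  shows "leaf_set (pverts (path_graph d)) (parcs (path_graph d)) = {0, d - 1}"
proof -
  have nb: "parcs (path_graph d) `` {i} =
      (if i = 0 then {1} else if i = d - 1 then {d - 2} else {i - 1, i + 1})" if "i < d" for i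
    using that assms by (auto simp: path_graph_def)
  have "card (parcs (path_graph d) `` {i}) = 1 \<longleftrightarrow> i = 0 \<or> i = d - 1" if "i < d" for i
    unfolding nb[OF that] by (auto simp: card_insert_if)
  then show ?thesis using assms by (auto simp: leaf_set_def) (auto simp: path_graph_def)
qed

lemma pverts_attach_paths:
  "pverts (attach_paths G d) = Inl ` pverts G \<union> Inr ` (pverts G \<times> {0..<d})"
  by (simp add: attach_paths_def path_graph_def)

lemma attach_paths_wf:
  assumes "pair_wf_digraph G" "0 < d"
  shows "pair_wf_digraph (attach_paths G d)"
proof -
  interpret pair_wf_digraph G by fact
  show ?thesis
    using assms(2) wellformed' by unfold_locales (auto simp: attach_paths_def path_graph_def)
qed

lemma attach_paths_arcs:
  "(Inl u, Inl v) \<in> parcs (attach_paths G d) \<longleftrightarrow> (u, v) \<in> parcs G"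
  "(Inl u, Inr (v, j)) \<in> parcs (attach_paths G d) \<longleftrightarrow> u \<in> pverts G \<and> v = u \<and> j = 0"
  "(Inr (u, i), Inl v) \<in> parcs (attach_paths G d) \<longleftrightarrow> u \<in> pverts G \<and> v = u \<and> i = 0"
  "(Inr (u, i), Inr (v, j)) \<in> parcs (attach_paths G d) \<longleftrightarrow>
    u \<in> pverts G \<and> v = u \<and> i < d \<and> j < d \<and> (j = i + 1 \<or> i = j + 1)"
  by (auto simp: attach_paths_def path_graph_def)

lemma card_pverts_attach_paths:
  assumes "finite (pverts G)"
  shows "card (pverts (attach_paths G d)) = (d + 1) * card (pverts G)"
proof -
  have "card (pverts (attach_paths G d)) =
      card (Inl ` pverts G :: ('a + 'a \<times> nat) set) + card (Inr ` (pverts G \<times> {0..<d}) :: ('a + 'a \<times> nat) set)"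
    unfolding pverts_attach_paths using assms by (intro card_Un_disjoint) auto
  then show ?thesis by (simp add: card_image card_cartesian_product)
qed

text \<open>\<open>Inl v\<close> is no leaf: besides its copy of the path it has a neighbour in
  \<open>G\<close>, which is connected with at least two vertices.\<close>

lemma attach_paths_leaf_set:
  assumes G: "graph_tree G" "2 \<le> card (pverts G)" and d: "2 \<le> d"
  shows "leaf_set (pverts (attach_paths G d)) (parcs (attach_paths G d)) =
    (\<lambda>v. Inr (v, d - 1)) ` pverts G" (is "leaf_set ?W ?F = _")
proof -
  have T: "utree (pverts G) (parcs G)" by (rule graph_tree_utree[OF G(1)])
  have inner: "card (?F `` {Inr (v, i)}) = (if i = d - 1 then 1 else 2)" if "v \<in> pverts G" "i < d" for v i
  proof -
    have "?F `` {Inr (v, i)} = (if i = 0 then {Inl v} else {Inr (v, i - 1)}) \<union>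
        (if i = d - 1 then {} else {Inr (v, i + 1)})"
    proof (rule set_eqI)
      fix y show "y \<in> ?F `` {Inr (v, i)} \<longleftrightarrow>
          y \<in> (if i = 0 then {Inl v} else {Inr (v, i - 1)}) \<union> (if i = d - 1 then {} else {Inr (v, i + 1)})"
        using that d by (cases y) (auto simp: attach_paths_arcs)
    qed
    then show ?thesis using d by auto
  qed
  have "card (?F `` {Inl v}) \<noteq> 1" if v: "v \<in> pverts G" for v
  proof
    assume one: "card (?F `` {Inl v}) = 1"
    have "\<exists>w. (v, w) \<in> parcs G"
    proof (rule ccontr)
      assume "\<nexists>w. (v, w) \<in> parcs G"
      then have "{v} = pverts G" using utree_closed_set[OF T, of "{v}"] v by auto
      then have "card (pverts G) = 1" by (metis One_nat_def card.empty card_insert_disjoint empty_iff finite.emptyI)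
      then show False using G by simp
    qed
    then obtain w where "(v, w) \<in> parcs G" by blast
    then have "Inl w \<in> ?F `` {Inl v}" "Inr (v, 0) \<in> ?F `` {Inl v}"
      using v by (auto simp: attach_paths_arcs)
    moreover obtain y where "?F `` {Inl v} = {y}" using one by (auto simp: card_1_singleton_iff)
    ultimately show False by (metis Inl_Inr_False singletonD)
  qed
  then have outer: "Inl v \<notin> leaf_set ?W ?F" if "v \<in> pverts G" for v
    using that by (simp add: leaf_set_def)
  have inner': "Inr (v, i) \<in> leaf_set ?W ?F \<longleftrightarrow> i = d - 1" if "v \<in> pverts G" "i < d" for v i
    using inner[OF that] that by (simp add: leaf_set_def pverts_attach_paths)
  have sub: "leaf_set ?W ?F \<subseteq> ?W" by (simp add: leaf_set_def)
  show ?thesis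
  proof (rule set_eqI)
    fix y
    show "y \<in> leaf_set ?W ?F \<longleftrightarrow> y \<in> (\<lambda>v. Inr (v, d - 1)) ` pverts G"
    proof (cases "y \<in> ?W")
      case True
      then consider v where "v \<in> pverts G" "y = Inl v"
        | v i where "v \<in> pverts G" "i < d" "y = Inr (v, i)"
        by (auto simp: pverts_attach_paths)
      then show ?thesis by cases (use outer inner' in auto)
    next
      case False
      then show ?thesis using sub d by (auto simp: pverts_attach_paths)
    qed
  qed
qed

text \<open>Within distance \<open>d\<close> of the far end of the copy at \<open>v\<close> lie only
  that copy and \<open>v\<close> itself. So the far ends of different copies need different
  dominators, and \<open>base\<close> maps \<open>S\<close> onto \<open>pverts G\<close>.\<close>

lemma attach_paths_iso_dom:
  assumes T: "pair_wf_digraph T" and d: "0 < d"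
    and h: "bij_betw h (pverts T) (pverts (attach_paths G d))"
      "\<And>u v. u \<in> pverts T \<Longrightarrow> v \<in> pverts T \<Longrightarrow>
        (u, v) \<in> parcs T \<longleftrightarrow> (h u, h v) \<in> parcs (attach_paths G d)"
    and S: "finite S" "S \<subseteq> pverts T" "distance_dominating d T S"
  shows "card (pverts G) \<le> card S"
proof -
  interpret pair_wf_digraph T by fact
  define base where "base w = (case h w of Inl a \<Rightarrow> a | Inr (a, i) \<Rightarrow> a)" for w
  have "v \<in> base ` S" if v: "v \<in> pverts G" for v
  proof -
    have "Inr (v, d - 1) \<in> h ` pverts T"
      using h(1) v d by (auto simp: bij_betw_def pverts_attach_paths)
    then obtain z where z: "z \<in> pverts T" "h z = Inr (v, d - 1)" by auto
    show ?thesis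
    proof (cases "z \<in> S")
      case True
      then show ?thesis using z by (auto simp: base_def intro!: image_eqI[of _ _ z])
    next
      case False
      then obtain u where u: "u \<in> S" "graph_dist T z u \<le> ereal (real d)"
        using S z by (auto simp: distance_dominating_def)
      \<comment> \<open>The distance from the far end of the copy at \<open>v\<close>, cut off at
        \<open>d + 1\<close>.\<close>
      define \<phi> where "\<phi> w = (case h w of Inl a \<Rightarrow> if a = v then d else d + 1
        | Inr (a, i) \<Rightarrow> if a = v then d - 1 - i else d + 1)" for w
      have "\<phi> b \<le> \<phi> a + 1" if ab: "(a, b) \<in> parcs T" for a b
      proof -
        have "(h a, h b) \<in> parcs (attach_paths G d)"
          using h(2) wellformed'(1)[OF ab] wellformed'(2)[OF ab] ab by blast
        then show ?thesis
          by (cases "h a"; cases "h b") (auto simp: \<phi>_def attach_paths_arcs)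
      qed
      then have "ereal (real (\<phi> u)) \<le> ereal (real (\<phi> z)) + graph_dist T z u"
        by (rule graph_dist_ge[OF T])
      also have "\<phi> z = 0" by (simp add: \<phi>_def z)
      finally have "ereal (real (\<phi> u)) \<le> graph_dist T z u" by simp
      also note u(2)
      finally have "\<phi> u \<le> d" by simp
      then have "base u = v" by (auto simp: \<phi>_def base_def split: sum.splits if_splits)
      then show ?thesis using u by auto
    qed
  qed
  then have "card (pverts G) \<le> card (base ` S)" using S by (intro card_mono) auto
  also have "\<dots> \<le> card S" using S by (intro card_image_le) auto
  finally show ?thesis .
qed

text \<open>The ends \<open>F z d\<close> of the pendant paths induce the tree \<open>G\<close> that
  carries the attached paths.\<close>

lemma extremal_in_tree_family:
  fixes T :: "'a pair_pre_digraph"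
  defines "V \<equiv> pverts T" and "E \<equiv> parcs T"
  assumes GT: "graph_tree T" and d: "2 \<le> d" and l2: "2 \<le> card (leaf_set V E)"
    and V: "card V = (d + 1) * card (leaf_set V E)"
    and min: "\<And>S. indep_dom d V E S \<Longrightarrow> card (leaf_set V E) \<le> card S"
  shows "in_tree_family d T"
proof -
  let ?L = "leaf_set V E"
  interpret T: pair_graph T using GT by (simp add: graph_tree_def)
  have T: "utree V E" unfolding V_def E_def by (rule graph_tree_utree[OF GT])
  then have sy: "\<And>u v. (u, v) \<in> E \<Longrightarrow> (v, u) \<in> E" and arcs: "E \<subseteq> V \<times> V" and finV: "finite V"
    by (auto simp: utree_def dest: symD)
  from extremal_pendants[OF T d l2 V min] obtain F where F_all:
    "(\<forall>z\<in>?L. pendant V E (F z) d) \<and>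
     (\<forall>z\<in>?L. \<forall>z'\<in>?L. \<forall>i\<le>d. \<forall>j\<le>d. F z i = F z' j \<longleftrightarrow> z = z' \<and> i = j) \<and>
     V = (\<Union>z\<in>?L. F z ` {..d})" ..
  have F: "pendant V E (F z) d" if "z \<in> ?L" for z
    using conjunct1[OF F_all] that by blast
  have uniq: "F z i = F z' j \<longleftrightarrow> z = z' \<and> i = j"
    if "z \<in> ?L" "z' \<in> ?L" "i \<le> d" "j \<le> d" for z z' i j
    using conjunct1[OF conjunct2[OF F_all]] that by blast
  have cover: "V = (\<Union>z\<in>?L. F z ` {..d})"
    by (rule conjunct2[OF conjunct2[OF F_all]])
  define p where "p v = (SOME p. v = F (fst p) (snd p) \<and> fst p \<in> ?L \<and> snd p \<le> d)" for v
  have p: "v = F (fst (p v)) (snd (p v)) \<and> fst (p v) \<in> ?L \<and> snd (p v) \<le> d" if "v \<in> V" for v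
    unfolding p_def
  proof (rule someI_ex)
    from that cover have "v \<in> (\<Union>z\<in>?L. F z ` {..d})" by simp
    then show "\<exists>p. v = F (fst p) (snd p) \<and> fst p \<in> ?L \<and> snd p \<le> d" by auto
  qed
  have FV: "F z i \<in> V" if "z \<in> ?L" "i \<le> d" for z i
    using F[OF that(1)] that(2) by (auto simp: pendant_def)
  have pF: "p (F z i) = (z, i)" if "z \<in> ?L" "i \<le> d" for z i
  proof -
    have "fst (p (F z i)) = z \<and> snd (p (F z i)) = i"
      using p[OF FV[OF that]] uniq[of z "fst (p (F z i))" i "snd (p (F z i))"] that by metis
    then show ?thesis by (simp add: prod_eq_iff)
  qed
  define W where "W = (\<lambda>z. F z d) ` ?L"
  define G where "G = \<lparr>pverts = W, parcs = E \<inter> W \<times> W\<rparr>"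
  have Wsub: "W \<subseteq> V" using FV by (auto simp: W_def)
  have cardW: "card W = card ?L"
    unfolding W_def using uniq by (intro card_image) (auto simp: inj_on_def)
  \<comment> \<open>Contracting each pendant path to its end maps walks of \<open>T\<close> to walks
    of \<open>G\<close>, which makes \<open>G\<close> connected.\<close>
  define \<rho> where "\<rho> v = F (fst (p v)) d" for v
  have \<rho>W: "\<rho> v = v" if "v \<in> W" for v using that by (auto simp: W_def \<rho>_def pF)
  have inner: "(F z i, F z' j) \<in> E \<longleftrightarrow> z' = z \<and> (j = i + 1 \<or> i = j + 1)"
    if z: "z \<in> ?L" "z' \<in> ?L" "i < d" "j \<le> d" for z z' i j
  proof
    assume e: "(F z i, F z' j) \<in> E"
    have "F z' j = F z (Suc i) \<or> 0 < i \<and> F z' j = F z (i - 1)"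
      using pendant_edge_cases[OF F[OF z(1)] z(3) e] .
    then show "z' = z \<and> (j = i + 1 \<or> i = j + 1)"
      using uniq[of z' z j "Suc i"] uniq[of z' z j "i - 1"] z by auto
  next
    assume a: "z' = z \<and> (j = i + 1 \<or> i = j + 1)"
    then show "(F z i, F z' j) \<in> E"
      using pendant_step[OF F[OF z(1)], of i] pendant_step[OF F[OF z(1)], of j] sy z by auto
  qed
  have Gwf: "pair_graph G"
  proof
    show "fst e \<in> pverts G" "snd e \<in> pverts G" "fst e \<noteq> snd e" if "e \<in> parcs G" for e
      using that T.no_loops by (auto simp: G_def E_def)
    show "finite (pverts G)" "finite (parcs G)"
      using finite_subset[OF Wsub finV] by (auto simp: G_def)
    show "symmetric (with_proj G)" using sy by (auto simp: symmetric_def sym_def G_def)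
  qed
  interpret G: pair_graph G by (rule Gwf)
  have "reachable (with_proj G) u v" if uv: "u \<in> W" "v \<in> W" for u v
  proof -
    have "(u, v) \<in> E\<^sup>*" using uv Wsub T unfolding utree_def by blast
    then have "reachable (with_proj G) u (\<rho> v)"
    proof (induction rule: rtrancl_induct)
      case base
      have "u \<in> pverts G" using uv by (simp add: G_def)
      then have "reachable (with_proj G) u u" by (rule G.reachable_refl)
      then show ?case using \<rho>W[OF uv(1)] by simp
    next
      case (step w y)
      have wy: "w \<in> V" "y \<in> V" using step arcs by auto
      obtain z i where z: "w = F z i" "z \<in> ?L" "i \<le> d" using p[OF wy(1)] by blast
      obtain z' j where z': "y = F z' j" "z' \<in> ?L" "j \<le> d" using p[OF wy(2)] by blast
      show ?case
      proof (cases "i = d \<and> j = d")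
        case True
        then have "(\<rho> w, \<rho> y) \<in> parcs G"
          using step(2) z z' by (auto simp: \<rho>_def pF G_def W_def)
        then show ?thesis using step.IH G.reachable_adj_trans by auto
      next
        case False
        then have "z = z'"
          using inner[of z z' i j] inner[of z' z j i] step(2) sy[OF step(2)] z z' by (cases "i < d") auto
        then show ?thesis using step.IH z z' by (simp add: \<rho>_def pF)
      qed
    qed
    then show ?thesis using uv \<rho>W by simp
  qed
  moreover have "W \<noteq> {}" using l2 cardW by auto
  ultimately have "connected (with_proj G)"
    unfolding connected_def strongly_connected_def
    using G.reachable_mk_symmetric_eq[OF G.sym_arcs] by (simp add: G_def)
  moreover have "subgraph (with_proj G) (with_proj T)"
    using Wsub T.wf_digraph_axioms G.wf_digraph_axioms
    by (auto simp: subgraph_def compatible_def G_def V_def E_def)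
  then have "\<not> (\<exists>q. pre_digraph.cycle (with_proj G) q \<and> length q \<ge> 3)"
    using GT T.subgraph_cycle unfolding graph_tree_def by blast
  ultimately have GG: "graph_tree G" using Gwf by (simp add: graph_tree_def)
  \<comment> \<open>Pendant paths are numbered from the leaf, attached copies from the vertex of
    attachment; hence the reversed index.\<close>
  define h where "h v = (if snd (p v) = d then Inl (F (fst (p v)) d)
    else Inr (F (fst (p v)) d, d - 1 - snd (p v)))" for v
  have hF: "h (F z i) = (if i = d then Inl (F z d) else Inr (F z d, d - 1 - i))"
    if "z \<in> ?L" "i \<le> d" for z i
    using that by (simp add: h_def pF)
  have "bij_betw h V (pverts (attach_paths G d))"
    unfolding bij_betw_def
  proof
    show "inj_on h V"
    proof (rule inj_onI)
      fix u v assume uv: "u \<in> V" "v \<in> V" "h u = h v"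
      obtain z i where z: "u = F z i" "z \<in> ?L" "i \<le> d" using p[OF uv(1)] by blast
      obtain z' j where z': "v = F z' j" "z' \<in> ?L" "j \<le> d" using p[OF uv(2)] by blast
      have "z = z' \<and> i = j" using uv(3) z z' uniq[of z z' d d] by (auto simp: hF split: if_splits)
      then show "u = v" using z z' by simp
    qed
    show "h ` V = pverts (attach_paths G d)"
    proof
      show "h ` V \<subseteq> pverts (attach_paths G d)"
      proof
        fix y assume "y \<in> h ` V"
        then obtain v where v: "v \<in> V" "y = h v" by auto
        obtain z i where "v = F z i" "z \<in> ?L" "i \<le> d" using p[OF v(1)] by blast
        then show "y \<in> pverts (attach_paths G d)"
          using v d by (auto simp: hF pverts_attach_paths G_def W_def)
      qed
      show "pverts (attach_paths G d) \<subseteq> h ` V"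
      proof
        fix y assume "y \<in> pverts (attach_paths G d)"
        then consider z where "z \<in> ?L" "y = Inl (F z d)"
          | z i where "z \<in> ?L" "i < d" "y = Inr (F z d, i)"
          by (auto simp: pverts_attach_paths G_def W_def)
        then show "y \<in> h ` V"
        proof cases
          case 1
          then show ?thesis using FV by (intro image_eqI[of _ _ "F z d"]) (auto simp: hF)
        next
          case 2
          then show ?thesis using FV by (intro image_eqI[of _ _ "F z (d - 1 - i)"]) (auto simp: hF)
        qed
      qed
    qed
  qed
  moreover have "(u, v) \<in> E \<longleftrightarrow> (h u, h v) \<in> parcs (attach_paths G d)" if uv: "u \<in> V" "v \<in> V" for u v
  proof -
    obtain z i where z: "u = F z i" "z \<in> ?L" "i \<le> d" using p[OF uv(1)] by blast
    obtain z' j where z': "v = F z' j" "z' \<in> ?L" "j \<le> d" using p[OF uv(2)] by blast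
    have W: "F z d \<in> pverts G" "F z' d \<in> pverts G" using z z' by (auto simp: G_def W_def)
    have eq: "F z' d = F z d \<longleftrightarrow> z' = z" using uniq[of z' z d d] z z' by simp
    consider "i = d" "j = d" | "i < d" | "i = d" "j < d" using z z' by linarith
    then show ?thesis
    proof cases
      case 1
      then show ?thesis using z z' W by (simp add: hF attach_paths_arcs) (auto simp: G_def)
    next
      case 2
      then have "(u, v) \<in> E \<longleftrightarrow> z' = z \<and> (j = i + 1 \<or> i = j + 1)" using inner z z' by simp
      also have "\<dots> \<longleftrightarrow> (h u, h v) \<in> parcs (attach_paths G d)"
        using 2 z z' W eq by (auto simp: hF attach_paths_arcs)
      finally show ?thesis .
    next
      case 3
      have "(u, v) \<in> E \<longleftrightarrow> (v, u) \<in> E" using sy by blast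
      also have "\<dots> \<longleftrightarrow> z = z' \<and> (i = j + 1 \<or> j = i + 1)" using inner 3 z z' by simp
      also have "\<dots> \<longleftrightarrow> (h u, h v) \<in> parcs (attach_paths G d)"
        using 3 z z' W eq by (auto simp: hF attach_paths_arcs)
      finally show ?thesis .
    qed
  qed
  moreover have "pair_wf_digraph (attach_paths G d)"
    using attach_paths_wf[OF graph_tree_wf[OF GG]] d by simp
  ultimately have "graph_iso T (attach_paths G d)"
    using graph_iso_iff[OF graph_tree_wf[OF GT]] unfolding V_def E_def by blast
  moreover have "2 \<le> card (pverts G)" using cardW l2 by (simp add: G_def)
  ultimately show ?thesis using GG unfolding in_tree_family_def by blast
qed

theorem theorem4p2:
  fixes T :: "'a pair_pre_digraph" and d n l :: nat
  assumes "d \<ge> 2"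
    and "graph_tree T"
    and "card (pverts T) = n"
    and "card (leaves T) = l"
    and "n \<ge> d"
  shows "real (indep_dist_dom_number d T) \<le> (real n + real l) / (real d + 2)
    \<and> (real (indep_dist_dom_number d T) = (real n + real l) / (real d + 2)
         \<longleftrightarrow> graph_iso T (path_graph d) \<or> in_tree_family d T)"
proof -
  let ?V = "pverts T" and ?E = "parcs T" and ?g = "indep_dist_dom_number d T"
  have wf: "pair_wf_digraph T" by (rule graph_tree_wf[OF assms(2)])
  have U: "utree ?V ?E" by (rule graph_tree_utree[OF assms(2)])
  have n: "card ?V = n" and l: "card (leaf_set ?V ?E) = l"
    using assms(3,4) by (simp_all add: leaves_eq_leaf_set)
  have arcs: "?E \<subseteq> ?V \<times> ?V" and finV: "finite ?V" using U by (auto simp: utree_def)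
  have ne: "?V \<noteq> {}" using n assms by auto
  have min: "?g \<le> card S" if "indep_dom d ?V ?E S" for S
    by (rule indep_dist_dom_number_le[OF wf that])
  have bound: "(d + 2) * ?g \<le> n + l"
    using utree_indep_dom_bound(1)[OF U assms(1) _ min] assms(5) n l by simp
  obtain S where S: "S \<subseteq> ?V" "distance_dominating d T S" "card S = ?g"
    using indep_dist_dom_number_attained[OF assms(2) ne assms(1)] .
  have finS: "finite S" using S finV finite_subset by blast
  have real_iff: "real ?g = (real n + real l) / (real d + 2) \<longleftrightarrow> (d + 2) * ?g = n + l"
  proof -
    have "real ?g = (real n + real l) / (real d + 2) \<longleftrightarrow> real ((d + 2) * ?g) = real (n + l)"
      by (simp add: field_simps)
    then show ?thesis by (simp only: of_nat_eq_iff)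
  qed
  have "real ((d + 2) * ?g) \<le> real (n + l)" using bound by (simp only: of_nat_le_iff)
  then have "real ?g \<le> (real n + real l) / (real d + 2)" by (simp add: field_simps)
  moreover have "(d + 2) * ?g = n + l \<longleftrightarrow> graph_iso T (path_graph d) \<or> in_tree_family d T"
  proof
    assume "(d + 2) * ?g = n + l"
    then consider "n = d" "l = 2" | "?g = l" "n = (d + 1) * l" "2 \<le> l"
      using utree_indep_dom_bound(2)[OF U assms(1) _ min] assms(5) n l by auto
    then show "graph_iso T (path_graph d) \<or> in_tree_family d T"
    proof cases
      case 1
      obtain h where h: "bij_betw h ?V {0..<card ?V}"
        "\<And>u v. u \<in> ?V \<Longrightarrow> v \<in> ?V \<Longrightarrow> (u, v) \<in> ?E \<longleftrightarrow> h v = h u + 1 \<or> h u = h v + (1 :: nat)"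
        using utree_two_leaves_path[OF U] 1 n l assms by blast
      have "h v < d" if "v \<in> ?V" for v using h(1) that 1 n by (auto simp: bij_betw_def)
      then have "\<forall>u\<in>?V. \<forall>v\<in>?V. (u, v) \<in> ?E \<longleftrightarrow> (h u, h v) \<in> parcs (path_graph d)"
        using h(2) by (simp add: path_graph_def)
      moreover have "bij_betw h ?V (pverts (path_graph d))" using h(1) 1 n by (simp add: path_graph_def)
      ultimately show ?thesis using graph_iso_iff[OF wf path_graph_wf] by blast
    next
      case 2
      then have "in_tree_family d T"
        using extremal_in_tree_family[OF assms(2,1)] min n l by simp
      then show ?thesis by simp
    qed
  next
    assume "graph_iso T (path_graph d) \<or> in_tree_family d T"
    \<comment> \<open>The general bound supplies the opposite inequality.\<close>
    then have "n + l \<le> (d + 2) * ?g"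
    proof
      assume "graph_iso T (path_graph d)"
      then obtain h where h: "bij_betw h ?V (pverts (path_graph d))"
        "\<And>u v. u \<in> ?V \<Longrightarrow> v \<in> ?V \<Longrightarrow> (u, v) \<in> ?E \<longleftrightarrow> (h u, h v) \<in> parcs (path_graph d)"
        using graph_iso_iff[OF wf path_graph_wf] by blast
      have "l = card (leaf_set (pverts (path_graph d)) (parcs (path_graph d)))"
        using card_leaf_set_iso[OF h arcs] l by (simp add: path_graph_def subset_iff)
      also have "\<dots> = 2" using path_graph_leaf_set assms(1) by auto
      finally have "l = 2" .
      moreover have "n = d" using bij_betw_same_card[OF h(1)] n by (simp add: path_graph_def)
      moreover have "S \<noteq> {}" using S(2) ne by (auto simp: distance_dominating_def)
      then have "?g \<noteq> 0" using S(3) finS by auto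
      then have "(d + 2) * 1 \<le> (d + 2) * ?g" by (intro mult_le_mono) auto
      ultimately show ?thesis by simp
    next
      assume "in_tree_family d T"
      then obtain G :: "'a pair_pre_digraph" where G: "graph_tree G" "2 \<le> card (pverts G)"
        "graph_iso T (attach_paths G d)" unfolding in_tree_family_def by blast
      have Hwf: "pair_wf_digraph (attach_paths G d)"
        using attach_paths_wf[OF graph_tree_wf[OF G(1)]] assms(1) by simp
      obtain h where h: "bij_betw h ?V (pverts (attach_paths G d))"
        "\<And>u v. u \<in> ?V \<Longrightarrow> v \<in> ?V \<Longrightarrow> (u, v) \<in> ?E \<longleftrightarrow> (h u, h v) \<in> parcs (attach_paths G d)"
        using G(3) graph_iso_iff[OF wf Hwf] by blast
      have "parcs (attach_paths G d) \<subseteq> pverts (attach_paths G d) \<times> pverts (attach_paths G d)"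
        using pair_wf_digraph.wellformed'[OF Hwf] by auto
      then have "l = card (leaf_set (pverts (attach_paths G d)) (parcs (attach_paths G d)))"
        using card_leaf_set_iso[OF h arcs] l by simp
      also have "\<dots> = card (pverts G)"
        unfolding attach_paths_leaf_set[OF G(1,2) assms(1)] by (intro card_image) (auto simp: inj_on_def)
      finally have "l = card (pverts G)" .
      moreover have "n = (d + 1) * card (pverts G)"
        using bij_betw_same_card[OF h(1)] n card_pverts_attach_paths[of G d] G(2)
        by (metis card.infinite not_numeral_le_zero)
      moreover have "card (pverts G) \<le> ?g"
        using attach_paths_iso_dom[OF wf _ h finS S(1,2)] S(3) assms(1) by simp
      then have "(d + 2) * card (pverts G) \<le> (d + 2) * ?g" by (rule mult_le_mono2)
      ultimately show ?thesis by simp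
    qed
    then show "(d + 2) * ?g = n + l" using bound by simp
  qed
  ultimately show ?thesis using real_iff by simp
qed

end
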